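(* Let $T>0$ and let $U_i:[0,T]\to\mathbb{C}^{m\times m}$, $i=1,2,\dots,n$, be continuous functions on $[0,T]$ such that $U_i(t)$ is unitary for each $t\in[0,T]$. Suppose that there exists $C>0$ such that $$\mathrm{dist}(U_i(t),U_j(t))\le Ct$$ for every $i,j=1,2,\dots,n$ and every $t\in[0,T]$. Then, for any $w\in\mathbb{R}^n$ with entries summing to $1$, $$\mathbb{A}(U_1(t),\dots,U_n(t);w)=\mathbb{G}(U_1(t),\dots,U_n(t);w)+O(t^3).$$
   Context: $\|\cdot\|$ is the Frobenius norm. For unitary $U,V\in\mathbb{C}^{m\times m}$, $\mathrm{dist}(U,V)=\frac1{\sqrt2}\|\log(U^*V)\|$ (with $\log$ the principal matrix logarithm) is the geodesic distance on the unitary group. For unitary matrices $U_1,\dots,U_n\in\mathbb{C}^{m\times m}$ and a weight vector $w\in\mathbb{R}^n$ with entries summing to $1$, the weighted arithmetic mean is $$\mathbb{A}(U_1,\dots,U_n;w)=\operatorname*{arg\,min}_{V\in\mathbb{C}^{m\times m},\,V^*V=I}\ \sum_{i=1}^nw_i\|V-U_i\|^2,$$ and the weighted geometric mean is $$\mathbb{G}(U_1,\dots,U_n;w)=\operatorname*{arg\,min}_{V\in\mathbb{C}^{m\times m},\,V^*V=I}\ \sum_{i=1}^nw_i\,\mathrm{dist}(V,U_i)^2.$$ $O(\cdot)$ is understood in the Frobenius norm as $t\to0$. *)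

theory Defs
  imports "HOL-Analysis.Analysis" "HOL-Library.Landau_Symbols"
begin

text \<open>
  The library norm on \<^typ>\<open>complex^'m^'m\<close> is the L2 norm of the L2 norms of the rows, i.e. the
  Frobenius norm. The class product and \<^const>\<open>exp\<close> do not provide the matrix exponential on this
  type (\<open>*\<close> is entrywise), so it is defined by its power series with respect to \<open>**\<close>.
\<close>

definition ctranspose :: "complex^'m^'n \<Rightarrow> complex^'n^'m" where
  "ctranspose A = (\<chi> i j. cnj (A $ j $ i))"

definition unitary :: "complex^'m^'m \<Rightarrow> bool" where
  "unitary V \<longleftrightarrow> ctranspose V ** V = mat 1"

definition matpow :: "complex^'m^'m \<Rightarrow> nat \<Rightarrow> complex^'m^'m" where
  "matpow A k = (((**) A) ^^ k) (mat 1)"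

definition mexp :: "complex^'m^'m \<Rightarrow> complex^'m^'m" where
  "mexp A = (\<Sum>k. matpow A k /\<^sub>R fact k)"

definition eigenval :: "complex^'m^'m \<Rightarrow> complex \<Rightarrow> bool" where
  "eigenval A c \<longleftrightarrow> (\<exists>v. v \<noteq> 0 \<and> A *v v = c *s v)"

text \<open>
  Principal matrix logarithm: the logarithm whose eigenvalues have imaginary part in
  \<open>(-\<pi>, \<pi>]\<close>. It is usually taken for matrices without eigenvalues on the closed negative real
  axis, where the open strip gives the same matrix. The half-open strip, on which the scalar
  exponential is still injective, also determines it when -1 is an eigenvalue; this makes the
  distance below meaningful on the whole unitary group, over which the means minimize.
\<close>

definition is_principal_log :: "complex^'m^'m \<Rightarrow> complex^'m^'m \<Rightarrow> bool" where
  "is_principal_log A X \<longleftrightarrow>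
     mexp X = A \<and> (\<forall>c. eigenval X c \<longrightarrow> - pi < Im c \<and> Im c \<le> pi)"

definition mlog :: "complex^'m^'m \<Rightarrow> complex^'m^'m" where
  "mlog A = (THE X. is_principal_log A X)"

definition unitary_dist :: "complex^'m^'m \<Rightarrow> complex^'m^'m \<Rightarrow> real" where
  "unitary_dist U V = 1 / sqrt 2 * norm (mlog (ctranspose U ** V))"

definition arithmetic_objective ::
    "('n::finite \<Rightarrow> complex^'m^'m) \<Rightarrow> real^'n \<Rightarrow> complex^'m^'m \<Rightarrow> real" where
  "arithmetic_objective U w V = (\<Sum>i\<in>UNIV. w $ i * (norm (V - U i))\<^sup>2)"

definition geometric_objective ::
    "('n::finite \<Rightarrow> complex^'m^'m) \<Rightarrow> real^'n \<Rightarrow> complex^'m^'m \<Rightarrow> real" where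
  "geometric_objective U w V = (\<Sum>i\<in>UNIV. w $ i * (unitary_dist V (U i))\<^sup>2)"

text \<open>
  \<^const>\<open>arg_min\<close> selects some minimizer, so the two constants below denote the means of the
  mathematical literature only where the minimizer exists and is unique. The predicates
  express that a given matrix is a minimizer.
\<close>

definition is_arithmetic_mean ::
    "('n::finite \<Rightarrow> complex^'m^'m) \<Rightarrow> real^'n \<Rightarrow> complex^'m^'m \<Rightarrow> bool" where
  "is_arithmetic_mean U w = is_arg_min (arithmetic_objective U w) unitary"

definition is_geometric_mean ::
    "('n::finite \<Rightarrow> complex^'m^'m) \<Rightarrow> real^'n \<Rightarrow> complex^'m^'m \<Rightarrow> bool" where
  "is_geometric_mean U w = is_arg_min (geometric_objective U w) unitary"

definition arithmetic_mean ::
    "('n::finite \<Rightarrow> complex^'m^'m) \<Rightarrow> real^'n \<Rightarrow> complex^'m^'m" where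
  "arithmetic_mean U w = arg_min (arithmetic_objective U w) unitary"

definition geometric_mean ::
    "('n::finite \<Rightarrow> complex^'m^'m) \<Rightarrow> real^'n \<Rightarrow> complex^'m^'m" where
  "geometric_mean U w = arg_min (geometric_objective U w) unitary"

end

(*
  Unitary matrices W = P diag(a) P^* and W' = Q diag(b) Q^* satisfy
  |f(W) - f(W')|^2 = sum_jk |(P^* Q)_jk|^2 |f(a_j) - f(b_k)|^2, so Frobenius norm estimates for
  functions of unitary matrices reduce to estimates for scalars on the unit circle.

  Both means minimize a sum of w_i Phi(V^* U_i), where Phi sums |z - 1|^2 or |Ln z|^2 over the
  spectrum of its argument. By compactness minimizers exist and are close to the U_i. At a minimizer
  the gradient sum_i w_i l(V^* U_i) vanishes, with l(z) = z - 1/z and l(z) = 2 Ln z respectively. Both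
  functions l have derivative 2 at 1, so near the U_i either gradient is expanding in V; this gives
  uniqueness and puts the means within O(t) of the U_i. As z - 1/z = 2 sinh(Ln z) = 2 Ln z + O(|z - 1|^3),
  the geodesic gradient at the arithmetic mean is O(t^3), and expansion turns this into the distance
  bound.
*)
theory Submission
  imports Defs "HOL-Computational_Algebra.Fundamental_Theorem_Algebra"
begin

section \<open>Matrices and the Frobenius norm\<close>

text \<open>Single weights may be negative, so convexity is out of reach and every estimate carries
  the sum \<open>\<Omega>\<close> of the absolute weights, which is at least 1. Only the square of
  its modulus is continuous on the whole circle; this suffices for the existence of minimizers and
  for a qualitative location of them, and everything finer happens near the identity. Even there no
  matrix function is differentiated: an inequality with quadratic remainder for pairs of scalars is
  summed over pairs of eigenvalues. Terms that involve only one of the two spectra fit into such a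
  double sum because the squared moduli of the entries of \<open>ctranspose P ** Q\<close> have row
  and column sums 1. The principal logarithm is singled out among all matrices, so its uniqueness is
  proved for candidates that need not be normal.\<close>

lemma norm_matrix_power2:
  fixes A :: "complex^'n^'m"
  shows "(norm A)\<^sup>2 = (\<Sum>i\<in>UNIV. \<Sum>j\<in>UNIV. (cmod (A $ i $ j))\<^sup>2)"
  by (simp add: norm_vec_def L2_set_def real_sqrt_pow2 sum_nonneg)

lemma norm_cvec_power2:
  fixes x :: "complex^'n"
  shows "(norm x)\<^sup>2 = (\<Sum>i\<in>UNIV. (cmod (x $ i))\<^sup>2)"
  by (simp add: norm_vec_def L2_set_def sum_nonneg)

lemma ctranspose_ctranspose [simp]: "ctranspose (ctranspose A) = A"
  by (simp add: ctranspose_def vec_eq_iff)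

lemma ctranspose_mult: "ctranspose (A ** B) = ctranspose B ** ctranspose A"
  by (simp add: ctranspose_def vec_eq_iff matrix_matrix_mult_def mult.commute)

lemma ctranspose_mat_1 [simp]: "ctranspose (mat 1) = mat 1"
  by (auto simp: ctranspose_def vec_eq_iff mat_def)

lemma ctranspose_diff: "ctranspose (A - B) = ctranspose A - ctranspose B"
  by (simp add: ctranspose_def vec_eq_iff)

lemma ctranspose_scaleR: "ctranspose (r *\<^sub>R A) = r *\<^sub>R ctranspose A"
  by (simp add: ctranspose_def vec_eq_iff)

lemma ctranspose_sum: "ctranspose (\<Sum>i\<in>I. f i) = (\<Sum>i\<in>I. ctranspose (f i))"
  by (simp add: ctranspose_def vec_eq_iff)

lemma norm_ctranspose [simp]: "norm (ctranspose A) = norm A"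
proof -
  have "(norm (ctranspose A))\<^sup>2 = (norm A)\<^sup>2"
    unfolding norm_matrix_power2 ctranspose_def by (subst sum.swap) simp
  then show ?thesis by simp
qed

lemma trace_ctranspose_mult: "trace (ctranspose A ** A) = of_real ((norm A)\<^sup>2)"
proof -
  have "trace (ctranspose A ** A) = (\<Sum>j\<in>UNIV. \<Sum>i\<in>UNIV. of_real ((cmod (A $ i $ j))\<^sup>2))"
    unfolding trace_def matrix_matrix_mult_def ctranspose_def
    by (simp add: complex_norm_square mult.commute del: of_real_power)
  then show ?thesis
    unfolding norm_matrix_power2 by (subst (asm) sum.swap) simp
qed

lemma trace_scaleR: "trace (r *\<^sub>R A) = r *\<^sub>R trace (A :: complex^'m^'m)"
  by (simp add: trace_def scaleR_sum_right)

lemma trace_sum: "trace (\<Sum>i\<in>I. f i) = (\<Sum>i\<in>I. trace (f i :: complex^'m^'m))"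
  unfolding trace_def by (simp add: sum.swap[of _ UNIV I])

lemma matrix_diff_ldistrib: "A ** (B - C) = A ** B - A ** (C :: 'a::ring_1^_^_)"
  by (simp add: matrix_matrix_mult_def vec_eq_iff right_diff_distrib sum_subtractf)

lemma matrix_diff_rdistrib: "(B - C) ** A = B ** A - C ** (A :: 'a::ring_1^_^_)"
  by (simp add: matrix_matrix_mult_def vec_eq_iff left_diff_distrib sum_subtractf)

lemma matrix_add_rdist: "(B + C) ** A = B ** A + C ** (A :: 'a::semiring_1^_^_)"
  by (simp add: matrix_matrix_mult_def vec_eq_iff distrib_right sum.distrib)

lemma matrix_scaleR_left: "(r *\<^sub>R A) ** B = r *\<^sub>R (A ** (B :: complex^_^_))"
  by (simp add: matrix_matrix_mult_def vec_eq_iff scaleR_sum_right)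

lemma matrix_scaleR_right: "A ** (r *\<^sub>R B) = r *\<^sub>R (A ** (B :: complex^_^_))"
  by (simp add: matrix_matrix_mult_def vec_eq_iff scaleR_sum_right)

lemma matrix_minus_left: "(- A) ** B = - (A ** (B :: 'a::ring_1^_^_))"
  by (simp add: matrix_matrix_mult_def vec_eq_iff sum_negf)

lemma matrix_minus_right: "A ** (- B) = - (A ** (B :: 'a::ring_1^_^_))"
  by (simp add: matrix_matrix_mult_def vec_eq_iff sum_negf)

lemma matrix_sum_left: "(\<Sum>i\<in>I. f i) ** A = (\<Sum>i\<in>I. f i ** (A :: 'a::semiring_1^_^_))"
  by (induction I rule: infinite_finite_induct) (auto simp: matrix_add_rdist)

text \<open>Cauchy-Schwarz bounds each entry of the product by a row of \<open>A\<close> against a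
  column of \<open>B\<close>; the sum of these bounds over \<open>i\<close> and \<open>j\<close>
  factors.\<close>

lemma norm_matrix_mult: "norm (A ** B) \<le> norm A * norm (B :: complex^'k^'n)"
  for A :: "complex^'n^'m"
proof -
  have "(norm (A ** B))\<^sup>2
      \<le> (\<Sum>i\<in>UNIV. \<Sum>j\<in>UNIV. (\<Sum>k\<in>UNIV. (cmod (A $ i $ k))\<^sup>2) * (\<Sum>k\<in>UNIV. (cmod (B $ k $ j))\<^sup>2))"
    unfolding norm_matrix_power2
  proof (intro sum_mono)
    fix i j
    have "cmod ((A ** B) $ i $ j) \<le> (\<Sum>k\<in>UNIV. cmod (A $ i $ k) * cmod (B $ k $ j))"
      unfolding matrix_matrix_mult_def by (simp add: norm_mult[symmetric] sum_norm_le)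
    then have "(cmod ((A ** B) $ i $ j))\<^sup>2 \<le> (\<Sum>k\<in>UNIV. cmod (A $ i $ k) * cmod (B $ k $ j))\<^sup>2"
      by (intro power_mono) auto
    also have "\<dots> \<le> (\<Sum>k\<in>UNIV. (cmod (A $ i $ k))\<^sup>2) * (\<Sum>k\<in>UNIV. (cmod (B $ k $ j))\<^sup>2)"
      by (rule Cauchy_Schwarz_ineq_sum)
    finally show "(cmod ((A ** B) $ i $ j))\<^sup>2
        \<le> (\<Sum>k\<in>UNIV. (cmod (A $ i $ k))\<^sup>2) * (\<Sum>k\<in>UNIV. (cmod (B $ k $ j))\<^sup>2)" .
  qed
  also have "\<dots> = (\<Sum>i\<in>UNIV. \<Sum>k\<in>UNIV. (cmod (A $ i $ k))\<^sup>2) * (\<Sum>j\<in>UNIV. \<Sum>k\<in>UNIV. (cmod (B $ k $ j))\<^sup>2)"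
    by (rule sum_product[symmetric])
  also have "(\<Sum>j\<in>UNIV. \<Sum>k\<in>UNIV. (cmod (B $ k $ j))\<^sup>2) = (norm B)\<^sup>2"
    unfolding norm_matrix_power2 by (rule sum.swap)
  also have "(\<Sum>i\<in>UNIV. \<Sum>k\<in>UNIV. (cmod (A $ i $ k))\<^sup>2) * (norm B)\<^sup>2 = (norm A * norm B)\<^sup>2"
    by (simp only: power_mult_distrib norm_matrix_power2)
  finally show ?thesis by (rule power2_le_imp_le) simp
qed

lemma bounded_bilinear_matrix_mult:
  "bounded_bilinear ((**) :: complex^'n^'m \<Rightarrow> complex^'k^'n \<Rightarrow> complex^'k^'m)"
proof
  show "\<exists>K. \<forall>(A :: complex^'n^'m) (B :: complex^'k^'n). norm (A ** B) \<le> norm A * norm B * K"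
    by (rule exI[of _ 1]) (simp add: norm_matrix_mult)
qed (simp_all add: matrix_add_ldistrib matrix_add_rdist matrix_scaleR_left matrix_scaleR_right)

section \<open>Unitary matrices and invariance of the norm\<close>

lemma unitary_alt: "unitary V \<longleftrightarrow> V ** ctranspose V = mat 1"
  unfolding unitary_def by (rule matrix_left_right_inverse)

lemma unitary_ctranspose: "unitary V \<Longrightarrow> unitary (ctranspose V)"
  using unitary_alt[of V] by (simp add: unitary_def)

lemma unitary_mat_1: "unitary (mat 1)"
  by (simp add: unitary_def)

lemma unitary_cancel:
  assumes "unitary V"
  shows "ctranspose V ** (V ** A) = A" "V ** (ctranspose V ** A) = A"
    "(A ** V) ** ctranspose V = A" "(A ** ctranspose V) ** V = A"
proof -
  have 1: "ctranspose V ** V = mat 1" "V ** ctranspose V = mat 1"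
    using assms unitary_alt[of V] by (auto simp: unitary_def)
  show "ctranspose V ** (V ** A) = A" "V ** (ctranspose V ** A) = A"
    by (simp_all add: matrix_mul_assoc 1)
  show "(A ** V) ** ctranspose V = A" "(A ** ctranspose V) ** V = A"
    by (simp_all add: 1 flip: matrix_mul_assoc)
qed

lemma unitary_mult:
  assumes "unitary U" "unitary V"
  shows "unitary (U ** V)"
  unfolding unitary_def ctranspose_mult
  using assms(2) by (simp add: unitary_cancel(1)[OF assms(1)] unitary_def flip: matrix_mul_assoc)

lemma norm_unitary_mult:
  fixes A :: "complex^'m^'m"
  assumes "unitary V"
  shows "norm (V ** A) = norm A"
proof -
  have "ctranspose (V ** A) ** (V ** A) = ctranspose A ** A"
    by (simp add: ctranspose_mult unitary_cancel(1)[OF assms] flip: matrix_mul_assoc)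
  then have "complex_of_real ((norm (V ** A))\<^sup>2) = of_real ((norm A)\<^sup>2)"
    by (simp only: flip: trace_ctranspose_mult)
  then show ?thesis by (simp del: of_real_power)
qed

lemma norm_mult_unitary:
  fixes A :: "complex^'m^'m"
  assumes "unitary V"
  shows "norm (A ** V) = norm A"
  by (metis assms ctranspose_mult norm_ctranspose norm_unitary_mult unitary_ctranspose)

text \<open>Trades the distance from \<open>V\<close> to a datum for the distance of
  \<open>ctranspose V ** U\<close> from the identity, the form in which both objectives are
  analysed.\<close>

lemma norm_unitary_ctranspose_mult_diff:
  fixes U V :: "complex^'m^'m"
  assumes "unitary V"
  shows "norm (ctranspose V ** U - mat 1) = norm (V - U)"
proof -
  have "ctranspose V ** U - mat 1 = ctranspose V ** (U - V)"
    using assms by (simp add: matrix_diff_ldistrib unitary_def)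
  then show ?thesis
    by (simp add: norm_unitary_mult unitary_ctranspose assms norm_minus_commute)
qed

section \<open>The spectral theorem\<close>

definition cinner :: "complex^'m \<Rightarrow> complex^'m \<Rightarrow> complex" where
  "cinner x y = (\<Sum>i\<in>UNIV. cnj (x $ i) * y $ i)"

lemma cinner_add_right: "cinner x (y + z) = cinner x y + cinner x z"
  by (simp add: cinner_def sum.distrib distrib_left)

lemma cinner_diff_right: "cinner x (y - z) = cinner x y - cinner x z"
  by (simp add: cinner_def sum_subtractf right_diff_distrib)

lemma cinner_diff_left: "cinner (x - y) z = cinner x z - cinner y z"
  by (simp add: cinner_def sum_subtractf left_diff_distrib)

lemma cinner_scale_right: "cinner x (c *s y) = c * cinner x y"
  by (simp add: cinner_def sum_distrib_left mult.left_commute)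

lemma cinner_scale_left: "cinner (c *s x) y = cnj c * cinner x y"
  by (simp add: cinner_def sum_distrib_left mult.assoc)

lemma cinner_zero_right [simp]: "cinner x 0 = 0"
  by (simp add: cinner_def)

lemma cinner_sum_right: "cinner x (\<Sum>i\<in>I. f i) = (\<Sum>i\<in>I. cinner x (f i))"
  by (induction I rule: infinite_finite_induct) (auto simp: cinner_add_right)

lemma cinner_self: "cinner x x = of_real ((norm x)\<^sup>2)"
  unfolding norm_cvec_power2 cinner_def
  by (simp add: complex_norm_square mult.commute del: of_real_power)

lemma cinner_matrix: "cinner (A *v x) y = cinner x (ctranspose A *v y)"
  unfolding cinner_def matrix_vector_mult_def ctranspose_def
  by (simp add: sum_distrib_left sum_distrib_right, subst sum.swap) (simp add: mult_ac)

lemma matrix_vector_mult_smult: "A *v (c *s x) = c *s (A *v (x :: complex^'n))"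
  by (rule vec.scale)

text \<open>The induction splits a root off the polynomial annihilating \<open>v\<close>.\<close>

lemma annihilating_poly_imp_eigenvector:
  fixes A :: "complex^'m^'m" and S :: "(complex^'m) set"
  assumes S: "vec.subspace S" "\<And>x. x \<in> S \<Longrightarrow> A *v x \<in> S"
    and "p \<noteq> 0" "v \<in> S" "v \<noteq> 0"
    and "(\<Sum>i\<le>degree p. coeff p i *s (((*v) A ^^ i) v)) = 0"
  shows "\<exists>x\<in>S. x \<noteq> 0 \<and> (\<exists>c. A *v x = c *s x)"
  using assms(3-)
proof (induction "degree p" arbitrary: p v)
  case 0
  then obtain a where "p = [:a:]" by (metis degree_eq_zeroE)
  with 0 show ?case by simp
next
  case (Suc n)
  then have "\<not> constant (poly p)" using constant_degree[of p] by auto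
  then obtain c where "poly p c = 0" using fundamental_theorem_of_algebra by blast
  then obtain q where pq: "p = [:-c, 1:] * q" by (auto simp: poly_eq_0_iff_dvd)
  then have "q \<noteq> 0" using Suc by auto
  then have dq: "degree q = n" using Suc.hyps(2) by (simp add: pq degree_mult_eq del: mult_pCons_left)
  \<comment> \<open>As \<open>p\<close> is \<open>x - c\<close> times \<open>q\<close>, the
    polynomial \<open>q\<close> annihilates \<open>(A - c) v\<close>. Either this vector is zero and
    \<open>v\<close> is an eigenvector, or the induction applies to it.\<close>
  define u where "u = A *v v - c *s v"
  have uS: "u \<in> S" unfolding u_def
    by (intro vec.subspace_diff vec.subspace_scale S Suc.prems(2))
  have pow: "((*v) A ^^ i) (x - c *s y) = ((*v) A ^^ i) x - c *s ((*v) A ^^ i) y" for i x y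
    by (induction i) (auto simp: matrix_vector_mult_diff_distrib vec.scale)
  have "(\<Sum>i\<le>degree q. coeff q i *s (((*v) A ^^ i) u))
      = (\<Sum>i\<le>n. coeff q i *s (((*v) A ^^ Suc i) v)) - (\<Sum>i\<le>n. (c * coeff q i) *s (((*v) A ^^ i) v))"
    unfolding u_def pow dq sum_subtractf[symmetric]
    by (intro sum.cong) (auto simp: vec.scale_right_diff_distrib funpow_swap1 mult.commute)
  also have "\<dots> = (\<Sum>i\<le>Suc n. coeff (pCons 0 q) i *s (((*v) A ^^ i) v))
                - (\<Sum>i\<le>Suc n. coeff (smult c q) i *s (((*v) A ^^ i) v))"
  proof -
    have "(\<Sum>i\<le>Suc n. coeff (pCons 0 q) i *s (((*v) A ^^ i) v))
        = (\<Sum>i\<le>n. coeff q i *s (((*v) A ^^ Suc i) v))"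
      by (subst sum.atMost_Suc_shift) simp
    moreover have "coeff q (Suc n) = 0" using dq by (simp add: coeff_eq_0)
    ultimately show ?thesis by simp
  qed
  also have "\<dots> = (\<Sum>i\<le>Suc n. coeff p i *s (((*v) A ^^ i) v))"
  proof -
    have "p = pCons 0 q - smult c q" by (simp add: pq)
    then have "coeff p i = coeff (pCons 0 q) i - coeff (smult c q) i" for i
      by (simp only: coeff_diff)
    then show ?thesis by (simp only: vec.scale_left_diff_distrib sum_subtractf)
  qed
  also have "\<dots> = 0" using Suc.prems(4) Suc.hyps(2) by simp
  finally have z: "(\<Sum>i\<le>degree q. coeff q i *s (((*v) A ^^ i) u)) = 0" .
  show ?case
  proof (cases "u = 0")
    case True
    then show ?thesis using Suc.prems(2,3) unfolding u_def by auto
  next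
    case False
    then show ?thesis using Suc.hyps(1)[OF _ \<open>q \<noteq> 0\<close> uS False z] dq by simp
  qed
qed

text \<open>The iterates \<open>v, A v, ..., A^n v\<close> are one more than the dimension
  \<open>n\<close>, so a linear relation among them gives a polynomial annihilating
  \<open>v\<close>.\<close>

lemma invariant_subspace_has_eigenvector:
  fixes A :: "complex^'m^'m" and S :: "(complex^'m) set"
  assumes S: "vec.subspace S" "\<And>x. x \<in> S \<Longrightarrow> A *v x \<in> S"
    and v: "v \<in> S" "v \<noteq> 0"
  shows "\<exists>x\<in>S. x \<noteq> 0 \<and> (\<exists>c. A *v x = c *s x)"
proof -
  define f where "f i = ((*v) A ^^ i) v" for i
  define n where "n = CARD('m)"
  have "\<exists>p. p \<noteq> 0 \<and> (\<Sum>i\<le>degree p. coeff p i *s f i) = 0"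
  proof (cases "inj_on f {..n}")
    case True
    have "vec.dependent (f ` {..n})"
    proof (rule ccontr)
      assume "\<not> ?thesis"
      then have "card (f ` {..n}) \<le> vec.dim (UNIV :: (complex^'m) set)"
        using vec.independent_card_le_dim[of "f ` {..n}" UNIV] by auto
      then show False using True by (simp add: card_image n_def vec_dim_card del: vec.dim_UNIV)
    qed
    then obtain u where u: "\<exists>x\<in>f ` {..n}. u x \<noteq> 0" "(\<Sum>x\<in>f ` {..n}. u x *s x) = 0"
      by (auto simp: vec.dependent_finite)
    define p where "p = (\<Sum>i\<le>n. monom (u (f i)) i)"
    have cp: "coeff p i = (if i \<le> n then u (f i) else 0)" for i
      unfolding p_def by (simp add: coeff_sum)
    have "p \<noteq> 0" using u(1) cp by (metis atMost_iff coeff_0 imageE)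
    have "degree p \<le> n" by (rule degree_le) (simp add: cp)
    then have "(\<Sum>i\<le>degree p. coeff p i *s f i) = (\<Sum>i\<le>n. coeff p i *s f i)"
      by (intro sum.mono_neutral_left) (auto simp: coeff_eq_0)
    also have "\<dots> = (\<Sum>x\<in>f ` {..n}. u x *s x)"
      by (subst sum.reindex[OF True]) (simp add: cp)
    finally show ?thesis using u \<open>p \<noteq> 0\<close> by auto
  next
    case False
    then obtain i j where ij: "i < j" "f i = f j"
      unfolding inj_on_def by (metis linorder_neqE_nat)
    \<comment> \<open>Dependence is a property of the set of iterates and does not see repetitions;
      a repeated iterate gives the relation \<open>x^j - x^i\<close> instead.\<close>
    define p where "p = (monom 1 j - monom 1 i :: complex poly)"
    have cp: "coeff p k = (if k = j then 1 else if k = i then -1 else 0)" for k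
      unfolding p_def using ij by auto
    have "degree p = j"
    proof (rule antisym)
      show "degree p \<le> j" by (rule degree_le) (use ij cp in auto)
      show "j \<le> degree p" by (rule le_degree) (use cp in auto)
    qed
    have "p \<noteq> 0" using cp[of j] by auto
    moreover have "(\<Sum>k\<le>j. coeff p k *s f k) = (\<Sum>k\<in>{i,j}. coeff p k *s f k)"
      by (rule sum.mono_neutral_right) (use ij cp in auto)
    then have "(\<Sum>k\<le>j. coeff p k *s f k) = 0" using ij by (auto simp: cp)
    ultimately show ?thesis using \<open>degree p = j\<close> by auto
  qed
  then obtain p where "p \<noteq> 0" "(\<Sum>i\<le>degree p. coeff p i *s f i) = 0" by blast
  then show ?thesis
    unfolding f_def using annihilating_poly_imp_eigenvector[OF S _ v] by blast
qed

text \<open>Normality makes \<open>ctranspose A *v x\<close> again an eigenvector of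
  \<open>A\<close> for \<open>c\<close>. With this and adjointness, all terms in the expanded
  squared length of the difference of the two sides cancel.\<close>

lemma normal_eigenvector_ctranspose:
  fixes A :: "complex^'m^'m"
  assumes A: "ctranspose A ** A = A ** ctranspose A" and x: "A *v x = c *s x"
  shows "ctranspose A *v x = cnj c *s x"
proof -
  have eq: "cinner (ctranspose A *v x) y = cinner x (A *v y)" for y
    using cinner_matrix[of "ctranspose A" x y] by simp
  have "A *v (ctranspose A *v x) = c *s (ctranspose A *v x)"
    by (simp add: matrix_vector_mul_assoc flip: A) (simp add: x matrix_vector_mult_smult flip: matrix_vector_mul_assoc)
  then have "cinner (ctranspose A *v x - cnj c *s x) (ctranspose A *v x - cnj c *s x) = 0"
    using cinner_matrix[of A x x]
    by (simp add: cinner_diff_right eq matrix_vector_mult_diff_distrib matrix_vector_mult_smult x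
        cinner_scale_right cinner_diff_left cinner_scale_left)
  then show ?thesis by (simp add: cinner_self del: of_real_power)
qed

definition diagm :: "complex^'m \<Rightarrow> complex^'m^'m" where
  "diagm d = (\<chi> i j. if i = j then d $ i else 0)"

text \<open>The orthogonal complement of fewer than \<open>CARD('m)\<close> eigenvectors is nonzero.
  As these are eigenvectors of the adjoint too, it is invariant under \<open>A\<close> and so
  contains a further eigenvector.\<close>

lemma normal_orthonormal_eigenvectors:
  fixes A :: "complex^'m^'m"
  assumes A: "ctranspose A ** A = A ** ctranspose A"
  shows "k \<le> CARD('m) \<Longrightarrow> \<exists>B. finite B \<and> card B = k \<and> (\<forall>x\<in>B. \<exists>c. A *v x = c *s x) \<and>
    (\<forall>x\<in>B. \<forall>y\<in>B. cinner x y = (if x = y then 1 else 0))"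
proof (induction k)
  case 0
  then show ?case by (intro exI[of _ "{}"]) auto
next
  case (Suc k)
  then obtain B where B: "finite B" "card B = k" "\<And>x. x \<in> B \<Longrightarrow> \<exists>c. A *v x = c *s x"
      "\<And>x y. x \<in> B \<Longrightarrow> y \<in> B \<Longrightarrow> cinner x y = (if x = y then 1 else 0)"
    by auto
  define S where "S = {y. \<forall>x\<in>B. cinner x y = 0}"
  have sub: "vec.subspace S"
    by (auto simp: S_def vec.subspace_def cinner_add_right cinner_scale_right)
  have inv: "A *v y \<in> S" if "y \<in> S" for y
  proof -
    have "cinner x (A *v y) = 0" if "x \<in> B" for x
    proof -
      obtain c where "A *v x = c *s x" using B(3) \<open>x \<in> B\<close> by blast
      then have "ctranspose A *v x = cnj c *s x" by (rule normal_eigenvector_ctranspose[OF A])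
      then show ?thesis
        using cinner_matrix[of "ctranspose A" x y] \<open>y \<in> S\<close> \<open>x \<in> B\<close>
        by (simp add: cinner_scale_left S_def)
    qed
    then show ?thesis by (simp add: S_def)
  qed
  have "vec.span B \<noteq> UNIV"
  proof
    assume "vec.span B = UNIV"
    then have "vec.dim (UNIV :: (complex^'m) set) \<le> card B"
      using vec.dim_le_card[of UNIV B] B(1) by simp
    then show False using B(2) Suc(2) by (simp add: vec_dim_card del: vec.dim_UNIV)
  qed
  then obtain y where y: "y \<notin> vec.span B" by auto
  \<comment> \<open>Subtracting from \<open>y\<close> its projection onto the span of
    \<open>B\<close> leaves a nonzero vector of \<open>S\<close>.\<close>
  define z where "z = y - (\<Sum>x\<in>B. cinner x y *s x)"
  have "(\<Sum>x\<in>B. cinner x y *s x) \<in> vec.span B"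
    by (intro vec.span_sum vec.span_scale vec.span_base)
  then have "z \<noteq> 0" using y by (auto simp: z_def)
  have "cinner x z = 0" if "x \<in> B" for x
  proof -
    have "cinner x z = cinner x y - (\<Sum>u\<in>B. cinner u y * cinner x u)"
      by (simp add: z_def cinner_diff_right cinner_sum_right cinner_scale_right)
    also have "(\<Sum>u\<in>B. cinner u y * cinner x u) = (\<Sum>u\<in>B. if u = x then cinner u y else 0)"
      by (intro sum.cong) (use B(4) that in auto)
    also have "\<dots> = cinner x y" using B(1) that by simp
    finally show ?thesis by simp
  qed
  then have "z \<in> S" by (simp add: S_def)
  then obtain v c where v: "v \<in> S" "v \<noteq> 0" "A *v v = c *s v"
    using invariant_subspace_has_eigenvector[OF sub inv _ \<open>z \<noteq> 0\<close>] by blast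
  define u where "u = of_real (1 / norm v) *s v"
  have uS: "cinner x u = 0" if "x \<in> B" for x
    using v(1) that by (simp add: u_def cinner_scale_right S_def)
  have uu: "cinner u u = 1"
  proof -
    have "cinner u u = of_real ((1 / norm v)\<^sup>2 * (norm v)\<^sup>2)"
      unfolding u_def cinner_scale_right cinner_scale_left unfolding cinner_self
      by (simp only: complex_cnj_complex_of_real of_real_mult power2_eq_square mult.assoc)
    also have "(1 / norm v)\<^sup>2 * (norm v)\<^sup>2 = 1"
      using v(2) by (simp add: power_one_over)
    finally show ?thesis by simp
  qed
  have "cinner u x = cnj (cinner x u)" for x
    by (simp add: cinner_def mult.commute)
  then have uS': "cinner u x = 0" if "x \<in> B" for x
    using uS[OF that] by simp
  have "u \<notin> B" using uS uu by force
  moreover have "A *v u = c *s u"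
    by (simp add: u_def matrix_vector_mult_smult v mult.commute)
  moreover have "cinner x y = (if x = y then 1 else 0)" if "x \<in> insert u B" "y \<in> insert u B" for x y
    using that \<open>u \<notin> B\<close> B(4) uS uS' uu by (cases "x = u"; cases "y = u") auto
  ultimately show ?case
    using B(1-3) by (intro exI[of _ "insert u B"]) (metis card_insert_disjoint finite_insert insert_iff)
qed

theorem normal_diagonalizable:
  fixes A :: "complex^'m^'m"
  assumes A: "ctranspose A ** A = A ** ctranspose A"
  obtains P d where "unitary P" "A = P ** diagm d ** ctranspose P"
proof -
  obtain B where B: "finite B" "card B = CARD('m)" "\<And>x. x \<in> B \<Longrightarrow> \<exists>c. A *v x = c *s x"
      "\<And>x y. x \<in> B \<Longrightarrow> y \<in> B \<Longrightarrow> cinner x y = (if x = y then 1 else 0)"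
    using normal_orthonormal_eigenvectors[OF A order_refl] by blast
  obtain f where f: "bij_betw f (UNIV :: 'm set) B"
    using finite_same_card_bij[OF finite_class.finite_UNIV B(1)] B(2) by auto
  have fB: "f j \<in> B" for j using f by (auto simp: bij_betw_def)
  have "\<forall>j. \<exists>c. A *v f j = c *s f j" using B(3) fB by blast
  then obtain d where d: "\<And>j. A *v f j = d j *s f j" by metis
  define P where "P = (\<chi> i j. f j $ i)"
  have "(ctranspose P ** P) $ i $ j = cinner (f i) (f j)" for i j
    by (simp add: matrix_matrix_mult_def ctranspose_def P_def cinner_def)
  moreover have "cinner (f i) (f j) = (if i = j then 1 else 0)" for i j
    using B(4)[OF fB fB] f by (auto simp: bij_betw_def inj_on_def)
  ultimately have P: "unitary P"
    by (simp add: unitary_def vec_eq_iff mat_def)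
  have "(A ** P) $ i $ j = (P ** diagm (vec_lambda d)) $ i $ j" for i j
  proof -
    have "(A ** P) $ i $ j = (A *v f j) $ i"
      by (simp add: matrix_matrix_mult_def matrix_vector_mult_def P_def)
    also have "\<dots> = P $ i $ j * d j" by (simp add: d P_def mult.commute)
    also have "\<dots> = (\<Sum>k\<in>UNIV. P $ i $ k * (if k = j then d k else 0))"
      by (simp add: if_distrib cong: if_cong)
    finally show ?thesis by (simp add: matrix_matrix_mult_def diagm_def cong: if_cong)
  qed
  then have "A ** P = P ** diagm (vec_lambda d)" by (simp add: vec_eq_iff)
  then have "A = P ** diagm (vec_lambda d) ** ctranspose P"
    using unitary_cancel(3)[OF P, of A] by simp
  with P show thesis by (rule that)
qed

section \<open>Functional calculus for unitary matrices\<close>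

lemma ctranspose_diagm: "ctranspose (diagm a) = diagm (\<chi> i. cnj (a $ i))"
  by (auto simp: diagm_def ctranspose_def vec_eq_iff)

lemma diagm_one [simp]: "diagm (\<chi> i. 1) = mat 1"
  by (auto simp: diagm_def mat_def vec_eq_iff)

lemma diagm_mult_nth: "(diagm a ** M) $ i $ j = a $ i * M $ i $ j"
  by (simp add: diagm_def matrix_matrix_mult_def if_distrib if_distribR cong: if_cong)

lemma diagm_mult: "diagm a ** diagm b = diagm (\<chi> i. a $ i * b $ i)"
  by (simp add: vec_eq_iff diagm_mult_nth) (simp add: diagm_def)

lemma mult_diagm_nth: "(M ** diagm a) $ i $ j = M $ i $ j * a $ j"
  by (simp add: diagm_def matrix_matrix_mult_def if_distrib cong: if_cong)

lemma diagm_mult_vec: "(diagm a *v x) $ i = a $ i * x $ i"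
  by (simp add: diagm_def matrix_vector_mult_def if_distrib if_distribR cong: if_cong)

text \<open>Kept as a function of the eigenvalue vector: for fixed unitary \<open>P\<close> it is
  linear and multiplicative for componentwise operations, and it preserves the norm.\<close>

definition conjd :: "complex^'m^'m \<Rightarrow> complex^'m \<Rightarrow> complex^'m^'m" where
  "conjd P a = P ** diagm a ** ctranspose P"

lemma ctranspose_conjd: "ctranspose (conjd P a) = conjd P (\<chi> i. cnj (a $ i))"
  by (simp add: conjd_def ctranspose_mult ctranspose_diagm matrix_mul_assoc)

lemma conjd_mult:
  assumes "unitary P"
  shows "conjd P a ** conjd P b = conjd P (\<chi> i. a $ i * b $ i)"
proof -
  have "conjd P a ** conjd P b = P ** (diagm a ** (ctranspose P ** (P ** (diagm b ** ctranspose P))))"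
    by (simp add: conjd_def flip: matrix_mul_assoc)
  also have "\<dots> = P ** (diagm a ** diagm b) ** ctranspose P"
    by (simp add: unitary_cancel[OF assms] matrix_mul_assoc)
  finally show ?thesis by (simp add: conjd_def diagm_mult)
qed

lemma conjd_one: "unitary P \<Longrightarrow> conjd P (\<chi> i. 1) = mat 1"
  by (simp add: conjd_def) (simp add: unitary_alt)

lemma diagm_linear: "linear (diagm :: complex^'m \<Rightarrow> _)"
  by (auto simp: linear_iff diagm_def vec_eq_iff)

lemma bounded_linear_conjd: "bounded_linear (conjd P)"
proof -
  have "bounded_linear (\<lambda>a. P ** (diagm a ** ctranspose P))"
    by (intro bounded_linear_compose[OF bounded_bilinear.bounded_linear_right[OF bounded_bilinear_matrix_mult]]
        bounded_linear_compose[OF bounded_bilinear.bounded_linear_left[OF bounded_bilinear_matrix_mult]])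
       (simp add: diagm_linear linear_linear flip: linear_conv_bounded_linear)
  then show ?thesis by (simp add: conjd_def[abs_def] matrix_mul_assoc)
qed

lemmas conjd_diff = bounded_linear_conjd[THEN bounded_linear.linear, THEN linear_diff]

text \<open>The doubly stochastic weights \<open>|M j k|\<^sup>2\<close>, \<open>M = P\<^sup>* Q\<close>, reduce statements on pairs of
  normal matrices to statements on pairs of eigenvalues.\<close>

lemma norm_conjd_diff:
  assumes P: "unitary P" and Q: "unitary Q"
  shows "(norm (conjd P a - conjd Q b))\<^sup>2
    = (\<Sum>j\<in>UNIV. \<Sum>k\<in>UNIV. (cmod (a $ j - b $ k))\<^sup>2 * (cmod ((ctranspose P ** Q) $ j $ k))\<^sup>2)"
proof -
  define M where "M = ctranspose P ** Q"
  have "ctranspose P ** ((conjd P a - conjd Q b) ** Q) = diagm a ** M - M ** diagm b"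
    unfolding conjd_def M_def matrix_diff_rdistrib matrix_diff_ldistrib
    by (simp add: unitary_cancel[OF P] unitary_cancel[OF Q] flip: matrix_mul_assoc)
       (use Q in \<open>simp add: unitary_def\<close>)
  then have "norm (conjd P a - conjd Q b) = norm (diagm a ** M - M ** diagm b)"
    by (metis norm_mult_unitary[OF Q] norm_unitary_mult unitary_ctranspose[OF P])
  moreover have "(diagm a ** M - M ** diagm b) $ j $ k = (a $ j - b $ k) * M $ j $ k" for j k
    by (simp add: diagm_mult_nth mult_diagm_nth algebra_simps)
  ultimately show ?thesis
    unfolding M_def[symmetric]
    by (simp add: norm_matrix_power2 norm_mult power_mult_distrib del: vector_minus_component)
qed

lemma norm_conjd:
  assumes P: "unitary P"
  shows "(norm (conjd P a))\<^sup>2 = (\<Sum>j\<in>UNIV. (cmod (a $ j))\<^sup>2)"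
proof -
  have "norm (conjd P a) = norm (diagm a)"
    unfolding conjd_def by (simp add: norm_mult_unitary norm_unitary_mult unitary_ctranspose P)
  moreover have "(cmod (diagm a $ i $ j))\<^sup>2 = (if i = j then (cmod (a $ j))\<^sup>2 else 0)" for i j
    by (simp add: diagm_def)
  ultimately show ?thesis by (simp add: norm_matrix_power2)
qed

text \<open>Cyclicity of the trace moves \<open>P\<close> to the right end, which leaves
  \<open>M\<close> and its adjoint between the diagonal factors. The weights are those of
  \<open>norm_conjd_diff\<close>, so linear terms and squared distances can be compared pair by
  pair.\<close>

lemma trace_conjd_mult:
  assumes P: "unitary P" and Q: "unitary Q"
  shows "trace (conjd P a ** conjd Q b)
    = (\<Sum>j\<in>UNIV. \<Sum>k\<in>UNIV. a $ j * b $ k * of_real ((cmod ((ctranspose P ** Q) $ j $ k))\<^sup>2))"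
proof -
  define M where "M = ctranspose P ** Q"
  have "trace (conjd P a ** conjd Q b)
      = trace (P ** (diagm a ** (M ** (diagm b ** ctranspose Q))))"
    by (simp add: conjd_def M_def flip: matrix_mul_assoc)
  also have "\<dots> = trace ((diagm a ** (M ** (diagm b ** ctranspose Q))) ** P)"
    by (rule trace_mul_sym)
  also have "\<dots> = trace ((diagm a ** M) ** (diagm b ** ctranspose M))"
    by (simp add: M_def ctranspose_mult flip: matrix_mul_assoc)
  also have "\<dots> = (\<Sum>j\<in>UNIV. \<Sum>k\<in>UNIV. (a $ j * M $ j $ k) * (b $ k * cnj (M $ j $ k)))"
    unfolding trace_def matrix_matrix_mult_def[of "diagm a ** M"]
    by (simp add: diagm_mult_nth ctranspose_def)
  finally show ?thesis
    unfolding M_def[symmetric] complex_norm_square by (simp add: mult_ac)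
qed

text \<open>The rows and columns of a unitary matrix have length 1. This allows a sum over one
  spectrum to be spread over pairs of eigenvalues.\<close>

lemma unitary_diag_weights:
  assumes P: "unitary P" and Q: "unitary Q"
  shows "(\<Sum>k\<in>UNIV. (cmod ((ctranspose P ** Q) $ j $ k))\<^sup>2) = 1"
    "(\<Sum>j\<in>UNIV. (cmod ((ctranspose P ** Q) $ j $ k))\<^sup>2) = 1"
proof -
  define M where "M = ctranspose P ** Q"
  have M: "unitary M" unfolding M_def by (intro unitary_mult unitary_ctranspose P Q)
  have "complex_of_real (\<Sum>k\<in>UNIV. (cmod (M $ j $ k))\<^sup>2) = (M ** ctranspose M) $ j $ j"
    by (simp add: matrix_matrix_mult_def ctranspose_def complex_norm_square del: of_real_power)
  also have "\<dots> = 1" using M by (simp add: unitary_alt mat_def)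
  finally show "(\<Sum>k\<in>UNIV. (cmod ((ctranspose P ** Q) $ j $ k))\<^sup>2) = 1"
    unfolding M_def using of_real_eq_1_iff by blast
  have "complex_of_real (\<Sum>j\<in>UNIV. (cmod (M $ j $ k))\<^sup>2) = (ctranspose M ** M) $ k $ k"
    by (simp add: matrix_matrix_mult_def ctranspose_def complex_norm_square mult.commute del: of_real_power)
  also have "\<dots> = 1" using M by (simp add: unitary_def mat_def)
  finally show "(\<Sum>j\<in>UNIV. (cmod ((ctranspose P ** Q) $ j $ k))\<^sup>2) = 1"
    unfolding M_def using of_real_eq_1_iff by blast
qed

definition diagonalizes :: "complex^'m^'m \<Rightarrow> complex^'m \<Rightarrow> complex^'m^'m \<Rightarrow> bool" where
  "diagonalizes P a A \<longleftrightarrow> unitary P \<and> A = conjd P a"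

lemma normal_diagonalizes:
  assumes "ctranspose A ** A = A ** ctranspose A"
  shows "\<exists>P a. diagonalizes P a A"
  using normal_diagonalizable[OF assms] unfolding diagonalizes_def conjd_def by metis

lemma unitary_diagonalizes: "unitary W \<Longrightarrow> \<exists>P a. diagonalizes P a W"
  by (rule normal_diagonalizes) (use unitary_alt[of W] in \<open>simp add: unitary_def\<close>)

lemma unitary_conjd_iff:
  assumes "unitary P"
  shows "unitary (conjd P a) \<longleftrightarrow> (\<forall>j. cmod (a $ j) = 1)"
proof -
  have "unitary (conjd P a) \<longleftrightarrow> conjd P (\<chi> i. cnj (a $ i) * a $ i) - conjd P (\<chi> i. 1) = 0"
    by (simp add: unitary_def ctranspose_conjd conjd_mult[OF assms] conjd_one[OF assms])
  also have "\<dots> \<longleftrightarrow> (norm (conjd P ((\<chi> i. cnj (a $ i) * a $ i) - (\<chi> i. 1))))\<^sup>2 = 0"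
    by (simp add: conjd_diff)
  also have "\<dots> \<longleftrightarrow> (\<forall>i. cnj (a $ i) * a $ i = 1)"
    by (simp add: norm_conjd[OF assms] sum_nonneg_eq_0_iff)
  also have "\<dots> \<longleftrightarrow> (\<forall>i. complex_of_real ((cmod (a $ i))\<^sup>2) = of_real 1)"
    unfolding complex_norm_square by (simp add: mult.commute)
  also have "\<dots> \<longleftrightarrow> (\<forall>i. cmod (a $ i) = 1)"
    by (simp only: of_real_eq_iff) (simp add: abs_square_eq_1)
  finally show ?thesis .
qed

lemma diagonalizes_cmod: "diagonalizes P a W \<Longrightarrow> unitary W \<Longrightarrow> cmod (a $ j) = 1"
  unfolding diagonalizes_def using unitary_conjd_iff by blast

definition fcalc :: "(complex \<Rightarrow> complex) \<Rightarrow> complex^'m^'m \<Rightarrow> complex^'m^'m" where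
  "fcalc h A = (let (P, a) = (SOME (P, a). diagonalizes P a A) in conjd P (\<chi> i. h (a $ i)))"

text \<open>Independence of the chosen diagonalization: two of them for the same matrix have
  \<open>b $ j = a $ k\<close> wherever the weight is nonzero, by \<open>norm_conjd_diff\<close>.
  Applying \<open>h\<close> keeps these equalities, and the same identity read backwards gives the
  claim.\<close>

lemma fcalc_conjd:
  assumes P: "unitary P"
  shows "fcalc h (conjd P a) = conjd P (\<chi> i. h (a $ i))"
proof -
  obtain Q b where Qb: "(SOME (Q, b). diagonalizes Q b (conjd P a)) = (Q, b)" by fastforce
  have "diagonalizes Q b (conjd P a)"
    using someI[of "\<lambda>(Q, b). diagonalizes Q b (conjd P a)" "(P, a)"] P
    unfolding Qb by (simp add: diagonalizes_def)
  then have Q: "unitary Q" and eq: "conjd Q b = conjd P a" by (auto simp: diagonalizes_def)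
  have "(norm (conjd Q b - conjd P a))\<^sup>2 = 0" using eq by simp
  then have z: "(cmod (b $ j - a $ k))\<^sup>2 * (cmod ((ctranspose Q ** P) $ j $ k))\<^sup>2 = 0" for j k
    unfolding norm_conjd_diff[OF Q P] by (simp add: sum_nonneg_eq_0_iff sum_nonneg)
  have "(cmod (h (b $ j) - h (a $ k)))\<^sup>2 * (cmod ((ctranspose Q ** P) $ j $ k))\<^sup>2 = 0" for j k
    using z[of j k] by auto
  then have "(norm (conjd Q (\<chi> i. h (b $ i)) - conjd P (\<chi> i. h (a $ i))))\<^sup>2 = 0"
    unfolding norm_conjd_diff[OF Q P] by (auto intro!: sum.neutral)
  then show ?thesis unfolding fcalc_def Qb by simp
qed

lemma fcalc_diagonalizes: "diagonalizes P a A \<Longrightarrow> fcalc h A = conjd P (\<chi> i. h (a $ i))"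
  unfolding diagonalizes_def using fcalc_conjd by blast

text \<open>Both squared norms are sums over pairs of eigenvalues with the same nonnegative weights,
  so the scalar bound passes to matrices with its constant unchanged.\<close>

lemma fcalc_lipschitz:
  assumes A: "diagonalizes P a A" and B: "diagonalizes Q b B" and "K \<ge> 0"
    and le: "\<And>j k. cmod (h (a $ j) - h (b $ k)) \<le> K * cmod (g (a $ j) - g (b $ k))"
  shows "norm (fcalc h A - fcalc h B) \<le> K * norm (fcalc g A - fcalc g B)"
proof -
  have P: "unitary P" and Q: "unitary Q" using A B by (auto simp: diagonalizes_def)
  have "(norm (fcalc h A - fcalc h B))\<^sup>2 \<le> (K * norm (fcalc g A - fcalc g B))\<^sup>2"
    unfolding fcalc_diagonalizes[OF A] fcalc_diagonalizes[OF B] power_mult_distrib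
      norm_conjd_diff[OF P Q] sum_distrib_left
  proof (intro sum_mono, goal_cases)
    case (1 j k)
    have "(cmod (h (a $ j) - h (b $ k)))\<^sup>2 \<le> (K * cmod (g (a $ j) - g (b $ k)))\<^sup>2"
      using le by (intro power_mono) auto
    then show ?case
      by (simp add: power_mult_distrib mult_right_mono flip: mult.assoc)
  qed
  then show ?thesis by (rule power2_le_imp_le) (simp add: \<open>K \<ge> 0\<close>)
qed

lemma fcalc_id: "diagonalizes P a A \<Longrightarrow> fcalc (\<lambda>z. z) A = A"
  using fcalc_diagonalizes[of P a A "\<lambda>z. z"] by (simp add: diagonalizes_def)

lemma fcalc_diff:
  assumes A: "diagonalizes P a A"
  shows "fcalc (\<lambda>z. h z - g z) A = fcalc h A - fcalc g A"
proof -
  have "fcalc h A - fcalc g A = conjd P ((\<chi> i. h (a $ i)) - (\<chi> i. g (a $ i)))"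
    by (simp add: fcalc_diagonalizes[OF A] conjd_diff)
  also have "(\<chi> i. h (a $ i)) - (\<chi> i. g (a $ i)) = (\<chi> i. h (a $ i) - g (a $ i))"
    by (simp add: vec_eq_iff)
  finally show ?thesis by (simp add: fcalc_diagonalizes[OF A])
qed

lemma fcalc_cmult_two:
  "diagonalizes P a A \<Longrightarrow> fcalc (\<lambda>z. 2 * h z) A = 2 *\<^sub>R fcalc h A"
proof -
  have "conjd P (2 *\<^sub>R (\<chi> i. h (a $ i))) = 2 *\<^sub>R conjd P (\<chi> i. h (a $ i))"
    by (rule linear_scale[OF bounded_linear.linear[OF bounded_linear_conjd]])
  moreover have "2 *\<^sub>R (\<chi> i. h (a $ i)) = (\<chi> i. 2 * h (a $ i))"
    by (simp add: vec_eq_iff scaleR_conv_of_real)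
  ultimately show "diagonalizes P a A \<Longrightarrow> ?thesis" by (simp add: fcalc_diagonalizes)
qed

lemma fcalc_commute:
  "diagonalizes P a A \<Longrightarrow> fcalc h A ** fcalc g A = fcalc g A ** fcalc h A"
  by (auto simp: diagonalizes_def fcalc_conjd conjd_mult mult.commute)

lemma diagonalizes_mat_1: "diagonalizes (mat 1) (\<chi> i. 1) (mat 1)"
  by (simp add: diagonalizes_def conjd_one unitary_mat_1)

lemma norm_fcalc:
  "diagonalizes P a A \<Longrightarrow> (norm (fcalc h A))\<^sup>2 = (\<Sum>j\<in>UNIV. (cmod (h (a $ j)))\<^sup>2)"
  by (auto simp: diagonalizes_def fcalc_conjd norm_conjd)

lemma norm_diff_mat_1:
  assumes "diagonalizes P a A"
  shows "(norm (A - mat 1))\<^sup>2 = (\<Sum>j\<in>UNIV. (cmod (a $ j - 1))\<^sup>2)"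
  using assms norm_conjd[of P "a - (\<chi> i. 1)"]
  by (simp add: diagonalizes_def conjd_diff conjd_one)

text \<open>Carries closeness of a matrix to the identity over to its eigenvalues, where the scalar
  estimates near 1 apply.\<close>

lemma spectrum_diff_mat_1:
  assumes "diagonalizes P a A"
  shows "cmod (a $ j - 1) \<le> norm (A - mat 1)"
proof -
  have "(cmod (a $ j - 1))\<^sup>2 \<le> (norm (A - mat 1))\<^sup>2"
    unfolding norm_diff_mat_1[OF assms] by (rule member_le_sum) auto
  then show ?thesis by (rule power2_le_imp_le) simp
qed

section \<open>The principal logarithm of a unitary matrix\<close>

lemma matpow_0: "matpow A 0 = mat 1"
  by (simp add: matpow_def)

lemma matpow_Suc: "matpow A (Suc k) = A ** matpow A k"
  by (simp add: matpow_def)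

lemma matpow_commute: "matpow A k ** A = A ** matpow A k"
  by (induction k) (simp_all add: matpow_0 matpow_Suc flip: matrix_mul_assoc)

lemma matpow_conjd: "unitary P \<Longrightarrow> matpow (conjd P a) k = conjd P (\<chi> i. a $ i ^ k)"
  by (induction k) (simp_all add: matpow_0 matpow_Suc conjd_one conjd_mult)

text \<open>The first factor accounts for \<open>k = 0\<close>: the Frobenius norm of the identity
  is the square root of the size, not 1.\<close>

lemma norm_matpow: "norm (matpow A k) \<le> norm (mat 1 :: complex^'m^'m) * norm A ^ k"
  for A :: "complex^'m^'m"
proof (induction k)
  case (Suc k)
  have "norm (matpow A (Suc k)) \<le> norm A * norm (matpow A k)"
    unfolding matpow_Suc by (rule norm_matrix_mult)
  also have "\<dots> \<le> norm A * (norm (mat 1 :: complex^'m^'m) * norm A ^ k)"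
    by (intro mult_left_mono Suc) auto
  finally show ?case by (simp add: mult_ac)
qed (simp add: matpow_0)

lemma mexp_sums:
  fixes A :: "complex^'m^'m"
  shows "(\<lambda>k. matpow A k /\<^sub>R fact k) sums mexp A"
proof -
  have "summable (\<lambda>k. norm (mat 1 :: complex^'m^'m) * (inverse (fact k) * norm A ^ k))"
    by (intro summable_mult summable_exp)
  then have "summable (\<lambda>k. matpow A k /\<^sub>R fact k)"
  proof (rule summable_comparison_test')
    fix k :: nat
    show "norm (matpow A k /\<^sub>R fact k) \<le> norm (mat 1 :: complex^'m^'m) * (inverse (fact k) * norm A ^ k)"
      using mult_left_mono[OF norm_matpow[of A k], of "inverse (fact k)"]
      by (simp add: mult_ac)
  qed
  then show ?thesis unfolding mexp_def by (rule summable_sums)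
qed

lemma mexp_commute: "mexp A ** A = A ** mexp A"
proof -
  have "(\<lambda>k. (matpow A k /\<^sub>R fact k) ** A) sums (mexp A ** A)"
    by (rule bounded_linear.sums[OF bounded_bilinear.bounded_linear_left[OF bounded_bilinear_matrix_mult] mexp_sums])
  moreover have "(\<lambda>k. A ** (matpow A k /\<^sub>R fact k)) sums (A ** mexp A)"
    by (rule bounded_linear.sums[OF bounded_bilinear.bounded_linear_right[OF bounded_bilinear_matrix_mult] mexp_sums])
  ultimately show ?thesis
    by (simp add: matrix_scaleR_left matrix_scaleR_right matpow_commute sums_unique2)
qed

lemma sums_vec_lambda:
  assumes "\<And>i. (\<lambda>k. f k i) sums (s i)"
  shows "(\<lambda>k. \<chi> i. f k i) sums ((\<chi> i. s i) :: complex^'m)"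
  unfolding sums_def
  by (rule vec_tendstoI) (use assms in \<open>simp add: sums_def\<close>)

lemma mexp_conjd:
  assumes P: "unitary P"
  shows "mexp (conjd P a) = conjd P (\<chi> i. exp (a $ i))"
proof -
  have "(\<lambda>k. \<chi> i. a $ i ^ k /\<^sub>R fact k) sums (\<chi> i. exp (a $ i))"
    by (rule sums_vec_lambda) (rule exp_converges)
  then have "(\<lambda>k. conjd P (\<chi> i. a $ i ^ k /\<^sub>R fact k)) sums conjd P (\<chi> i. exp (a $ i))"
    by (rule bounded_linear.sums[OF bounded_linear_conjd])
  moreover have "conjd P (\<chi> i. a $ i ^ k /\<^sub>R fact k) = matpow (conjd P a) k /\<^sub>R fact k" for k
  proof -
    have "(\<chi> i. a $ i ^ k /\<^sub>R fact k) = (\<chi> i. a $ i ^ k) /\<^sub>R fact k" by (simp add: vec_eq_iff)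
    then show ?thesis
      by (simp add: matpow_conjd[OF P] linear_scale[OF bounded_linear.linear[OF bounded_linear_conjd]])
  qed
  ultimately show ?thesis
    using mexp_sums[of "conjd P a"] by (simp add: sums_unique2)
qed

text \<open>On \<open>u\<close> and \<open>w\<close> the matrix acts like a Jordan block of size
  two, so \<open>w\<close> is multiplied by the derivative of the exponential at \<open>c\<close>,
  again \<open>exp c\<close>. The case \<open>w = 0\<close> is the one of a plain
  eigenvector.\<close>

lemma mexp_Jordan_chain:
  fixes X :: "complex^'m^'m"
  assumes u: "X *v u = c *s u + w" and w: "X *v w = c *s w"
  shows "mexp X *v u = exp c *s u + exp c *s w"
proof -
  \<comment> \<open>At \<open>k = 0\<close> the truncated exponent \<open>k - 1\<close> does no
    harm, as the factor \<open>of_nat k\<close> is zero.\<close>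
  have mp: "matpow X k *v u = c ^ k *s u + (of_nat k * c ^ (k - 1)) *s w" for k
  proof (induction k)
    case (Suc k)
    have "matpow X (Suc k) *v u = X *v (matpow X k *v u)"
      by (simp add: matpow_Suc matrix_vector_mul_assoc)
    also have "\<dots> = c ^ k *s (c *s u + w) + (of_nat k * c ^ (k - 1)) *s (c *s w)"
      by (simp add: Suc matrix_vector_right_distrib matrix_vector_mult_smult u w)
    also have "\<dots> = c ^ Suc k *s u + (of_nat (Suc k) * c ^ k) *s w"
      by (cases k) (auto simp: vec_eq_iff algebra_simps)
    finally show ?case by simp
  qed (simp add: matpow_0)
  have "(\<lambda>k. (matpow X k /\<^sub>R fact k) *v u) sums (mexp X *v u)"
  proof (rule bounded_linear.sums[OF _ mexp_sums])
    show "bounded_linear (\<lambda>A. A *v u)"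
      by (rule linear_conv_bounded_linear[THEN iffD1])
         (auto simp: linear_iff vec_eq_iff matrix_vector_mult_def scaleR_sum_right distrib_right sum.distrib)
  qed
  moreover have "(\<lambda>k. (matpow X k /\<^sub>R fact k) *v u) = (\<lambda>k. \<chi> i. (c ^ k /\<^sub>R fact k) * u $ i
      + ((of_nat k * c ^ (k - 1)) /\<^sub>R fact k) * w $ i)"
  proof
    fix k
    have "(matpow X k /\<^sub>R fact k) *v u = (matpow X k *v u) /\<^sub>R fact k"
      by (simp add: vec_eq_iff matrix_vector_mult_def scaleR_sum_right)
    then show "(matpow X k /\<^sub>R fact k) *v u = (\<chi> i. (c ^ k /\<^sub>R fact k) * u $ i
      + ((of_nat k * c ^ (k - 1)) /\<^sub>R fact k) * w $ i)"
      unfolding mp by (simp add: vec_eq_iff scaleR_add_right)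
  qed
  moreover have "(\<lambda>k. \<chi> i. (c ^ k /\<^sub>R fact k) * u $ i + ((of_nat k * c ^ (k - 1)) /\<^sub>R fact k) * w $ i)
      sums (\<chi> i. exp c * u $ i + exp c * w $ i)"
  proof (rule sums_vec_lambda, intro sums_add sums_mult2)
    show "(\<lambda>k. c ^ k /\<^sub>R fact k) sums exp c" by (rule exp_converges)
    \<comment> \<open>The termwise derivative of the exponential series is that series shifted by
      one index; its term at 0 vanishes.\<close>
    have "(\<lambda>k. (of_nat (Suc k) * c ^ (Suc k - 1)) /\<^sub>R fact (Suc k)) = (\<lambda>k. c ^ k /\<^sub>R fact k)"
      by (rule ext) (simp add: scaleR_conv_of_real field_simps del: of_nat_Suc)
    then have "(\<lambda>k. (of_nat (Suc k) * c ^ (Suc k - 1)) /\<^sub>R fact (Suc k)) sums exp c"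
      using exp_converges[of c] by simp
    then show "(\<lambda>k. (of_nat k * c ^ (k - 1)) /\<^sub>R fact k) sums exp c"
      by (subst (asm) sums_Suc_iff) simp
  qed
  ultimately have "mexp X *v u = (\<chi> i. exp c * u $ i + exp c * w $ i)"
    by (simp add: sums_unique2)
  then show ?thesis by (simp add: vec_eq_iff)
qed

lemma exp_eq_strip:
  assumes "exp x = exp (y :: complex)" "- pi < Im x" "Im x \<le> pi" "- pi < Im y" "Im y \<le> pi"
  shows "x = y"
  using assms by (metis Ln_exp)

text \<open>On an eigenspace of \<open>mexp X\<close> the only eigenvalue of \<open>X\<close> in the strip is \<open>c\<close>, and a Jordan
  chain of length two would move a vector under \<open>exp (-c) mexp X\<close>; hence \<open>X - c\<close> vanishes there.\<close>

lemma eigenvector_mexp: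
  fixes X :: "complex^'m^'m"
  assumes eig: "\<And>d. eigenval X d \<Longrightarrow> - pi < Im d \<and> Im d \<le> pi"
    and c: "- pi < Im c" "Im c \<le> pi" and v: "mexp X *v v = exp c *s v"
  shows "X *v v = c *s v"
proof (rule ccontr)
  assume neq: "X *v v \<noteq> c *s v"
  \<comment> \<open>If \<open>X - c\<close> does not vanish on the eigenspace \<open>E\<close> of
    \<open>mexp X\<close>, its image \<open>S\<close> is a nonzero subspace. It is invariant because
    \<open>X\<close> commutes with \<open>mexp X\<close>, and so it contains an eigenvector
    \<open>w = (X - c) u\<close> of \<open>X\<close>.\<close>
  define S where "S = {X *v u - c *s u | u. mexp X *v u = exp c *s u}"
  define E where "E = {u. mexp X *v u = exp c *s u}"
  have S: "S = (\<lambda>u. X *v u - c *s u) ` E" by (auto simp: S_def E_def)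
  have E: "vec.subspace E"
    by (auto simp: E_def vec.subspace_def matrix_vector_right_distrib matrix_vector_mult_smult
        vec.scale_right_distrib mult.commute)
  have "X *v (x + y) - c *s (x + y) = (X *v x - c *s x) + (X *v y - c *s y)"
    "X *v (r *s x) - c *s (r *s x) = r *s (X *v x - c *s x)" for x y r
    by (simp_all add: matrix_vector_right_distrib matrix_vector_mult_smult vec.scale_right_distrib
        vec.scale_right_diff_distrib mult.commute)
  then have "Vector_Spaces.linear (*s) (*s) (\<lambda>u. X *v u - c *s u)"
    unfolding Vector_Spaces.linear_iff using vec.vector_space_axioms by blast
  then have sub: "vec.subspace S" unfolding S by (rule vec.linear_subspace_image[OF _ E])
  have inv: "X *v y \<in> S" if "y \<in> S" for y
  proof -
    from that obtain u where u: "u \<in> E" "y = X *v u - c *s u" by (auto simp: S)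
    have "mexp X *v (X *v u) = X *v (mexp X *v u)"
      by (simp add: matrix_vector_mul_assoc mexp_commute)
    then have "X *v u \<in> E" using u(1) by (simp add: E_def matrix_vector_mult_smult)
    moreover have "X *v y = X *v (X *v u) - c *s (X *v u)"
      by (simp add: u matrix_vector_mult_diff_distrib matrix_vector_mult_smult)
    ultimately show ?thesis unfolding S by auto
  qed
  have "X *v v - c *s v \<in> S" "X *v v - c *s v \<noteq> 0" using v neq by (auto simp: S_def)
  then obtain w d where w: "w \<in> S" "w \<noteq> 0" "X *v w = d *s w"
    using invariant_subspace_has_eigenvector[OF sub inv] by blast
  obtain u where u: "u \<in> E" "w = X *v u - c *s u" using w(1) by (auto simp: S)
  have "mexp X *v (X *v u) = X *v (mexp X *v u)"
    by (simp add: matrix_vector_mul_assoc mexp_commute)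
  then have wE: "mexp X *v w = exp c *s w"
    using u by (simp add: E_def matrix_vector_mult_diff_distrib matrix_vector_mult_smult
        vec.scale_right_diff_distrib mult.commute)
  have "mexp X *v w = exp d *s w"
    using mexp_Jordan_chain[of X w d 0] w(3) by simp
  with wE w(2) have "exp d = exp c" by simp
  moreover have "- pi < Im d \<and> Im d \<le> pi" using eig w(2,3) unfolding eigenval_def by blast
  ultimately have "d = c" using exp_eq_strip[of d c] c by blast
  \<comment> \<open>Since \<open>d = c\<close>, the pair \<open>u\<close>, \<open>w\<close> is a
    Jordan chain. But \<open>u\<close> lies in \<open>E\<close>, which leaves no room for the term
    \<open>exp c *s w\<close>.\<close>
  then have "mexp X *v u = exp c *s u + exp c *s w"
    using u(2) w(3) by (intro mexp_Jordan_chain) auto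
  then have "exp c *s w = 0" using u(1) by (simp add: E_def)
  then show False using w(2) by simp
qed

lemma mult_column_nth: "(A *v column j B) $ i = (A ** B) $ i $ j"
  by (simp add: column_def matrix_matrix_mult_def matrix_vector_mult_def)

lemma conjd_mult_column:
  assumes P: "unitary P"
  shows "conjd P a *v column j P = a $ j *s column j P"
proof -
  have "conjd P a ** P = P ** diagm a"
    unfolding conjd_def by (rule unitary_cancel(4)[OF P])
  then show ?thesis
    by (simp add: vec_eq_iff mult_column_nth mult_diagm_nth) (simp add: column_def mult.commute)
qed

lemma eigenval_conjd:
  assumes P: "unitary P" and "eigenval (conjd P a) c"
  shows "\<exists>j. c = a $ j"
proof -
  obtain v where v: "v \<noteq> 0" "conjd P a *v v = c *s v" using assms(2) by (auto simp: eigenval_def)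
  define u where "u = ctranspose P *v v"
  have "P *v u = v" using P by (simp add: u_def matrix_vector_mul_assoc unitary_alt)
  then have "u \<noteq> 0" using v(1) by auto
  then obtain j where j: "u $ j \<noteq> 0" by (auto simp: vec_eq_iff)
  have "ctranspose P *v (conjd P a *v v) = diagm a *v u"
    by (simp add: u_def conjd_def matrix_vector_mul_assoc unitary_cancel[OF P] flip: matrix_mul_assoc)
  then have "diagm a *v u = c *s u"
    by (simp add: v(2) u_def matrix_vector_mult_smult)
  then have "(diagm a *v u) $ j = c * u $ j" by simp
  then show ?thesis using j by (auto simp: diagm_mult_vec)
qed

lemma is_principal_log_fcalc:
  fixes W :: "complex^'m^'m"
  assumes W: "unitary W"
  shows "is_principal_log W (fcalc Ln W)"
proof -
  obtain P a where D: "diagonalizes P a W" using unitary_diagonalizes[OF W] by blast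
  then have P: "unitary P" and eq: "W = conjd P a" by (auto simp: diagonalizes_def)
  have a: "a $ j \<noteq> 0" for j using diagonalizes_cmod[OF D W, of j] by auto
  show ?thesis
    unfolding is_principal_log_def fcalc_diagonalizes[OF D]
  proof (intro conjI allI impI)
    show "mexp (conjd P (\<chi> i. Ln (a $ i))) = W"
      by (simp add: mexp_conjd[OF P] a eq)
    fix c assume "eigenval (conjd P (\<chi> i. Ln (a $ i))) c"
    then obtain j where "c = Ln (a $ j)" using eigenval_conjd[OF P] by fastforce
    then show "- pi < Im c" "Im c \<le> pi" using a[of j] by (auto simp: mpi_less_Im_Ln Im_Ln_le_pi)
  qed
qed

text \<open>Normality of \<open>X\<close> is not assumed. By \<open>eigenvector_mexp\<close>, each
  column of \<open>P\<close> is an eigenvector of \<open>X\<close> with the prescribed eigenvalue,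
  and the columns determine the matrix.\<close>

lemma is_principal_log_unique:
  fixes W :: "complex^'m^'m"
  assumes W: "unitary W" and X: "is_principal_log W X"
  shows "X = fcalc Ln W"
proof -
  obtain P a where D: "diagonalizes P a W" using unitary_diagonalizes[OF W] by blast
  then have P: "unitary P" and eq: "W = conjd P a" by (auto simp: diagonalizes_def)
  have a: "a $ j \<noteq> 0" for j using diagonalizes_cmod[OF D W, of j] by auto
  have "X *v column j P = Ln (a $ j) *s column j P" for j
  proof (rule eigenvector_mexp)
    show "mexp X *v column j P = exp (Ln (a $ j)) *s column j P"
      using X conjd_mult_column[OF P, of a j] a by (simp add: is_principal_log_def eq)
  qed (use X a in \<open>auto simp: is_principal_log_def mpi_less_Im_Ln Im_Ln_le_pi\<close>)
  then have "(X ** P) $ i $ j = Ln (a $ j) * P $ i $ j" for i j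
    by (simp add: mult_column_nth[symmetric]) (simp add: column_def)
  then have "X ** P = P ** diagm (\<chi> i. Ln (a $ i))"
    by (simp add: vec_eq_iff mult_diagm_nth mult.commute)
  then have "X = P ** diagm (\<chi> i. Ln (a $ i)) ** ctranspose P"
    using unitary_cancel(3)[OF P, of X] by simp
  then show ?thesis by (simp add: fcalc_diagonalizes[OF D] conjd_def)
qed

lemma mlog_unitary: "unitary W \<Longrightarrow> mlog W = fcalc Ln W"
  unfolding mlog_def by (blast intro: the_equality is_principal_log_fcalc is_principal_log_unique)

section \<open>Minimizing weighted sums of spectral functions\<close>

lemma continuous_on_matrix_mult [continuous_intros]:
  fixes f :: "_ \<Rightarrow> complex^'n^'m" and g :: "_ \<Rightarrow> complex^'k^'n"
  shows "continuous_on S f \<Longrightarrow> continuous_on S g \<Longrightarrow> continuous_on S (\<lambda>x. f x ** g x)"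
  by (rule bounded_bilinear.continuous_on[OF bounded_bilinear_matrix_mult])

lemma continuous_on_ctranspose [continuous_intros]:
  "continuous_on S f \<Longrightarrow> continuous_on S (\<lambda>x. ctranspose (f x))"
  unfolding ctranspose_def by (intro continuous_intros)

lemma continuous_on_diagm [continuous_intros]:
  "continuous_on S f \<Longrightarrow> continuous_on S (\<lambda>x. diagm (f x))"
  by (rule bounded_linear.continuous_on[of diagm])
     (simp add: diagm_linear flip: linear_conv_bounded_linear)

lemma norm_unitary: "unitary (V :: complex^'m^'m) \<Longrightarrow> norm V = norm (mat 1 :: complex^'m^'m)"
  using norm_unitary_mult[of V "mat 1"] by simp

lemma compact_unitary: "compact {V :: complex^'m^'m. unitary V}"
proof (rule compact_eq_bounded_closed[THEN iffD2], rule conjI)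
  show "bounded {V :: complex^'m^'m. unitary V}"
    unfolding bounded_iff using norm_unitary by (metis mem_Collect_eq order_refl)
  show "closed {V :: complex^'m^'m. unitary V}"
    unfolding unitary_def by (intro closed_Collect_eq continuous_intros)
qed

lemma compact_torus: "compact {a :: complex^'m. \<forall>j. cmod (a $ j) = 1}"
proof (rule compact_eq_bounded_closed[THEN iffD2], rule conjI)
  have "norm a \<le> sqrt (real CARD('m))" if "\<forall>j. cmod (a $ j) = 1" for a :: "complex^'m"
    using norm_cvec_power2[of a] that by (intro real_le_rsqrt) simp
  then show "bounded {a :: complex^'m. \<forall>j. cmod (a $ j) = 1}"
    unfolding bounded_iff by blast
  show "closed {a :: complex^'m. \<forall>j. cmod (a $ j) = 1}"
    by (intro closed_Collect_all closed_Collect_eq continuous_intros)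
qed

lemma trace_conjd:
  assumes P: "unitary P"
  shows "trace (conjd P a) = (\<Sum>j\<in>UNIV. a $ j)"
proof -
  have "trace (conjd P a) = trace (P ** (diagm a ** ctranspose P))"
    by (simp add: conjd_def flip: matrix_mul_assoc)
  also have "\<dots> = trace (diagm a)"
    by (subst trace_mul_sym) (simp add: unitary_cancel[OF P])
  finally show ?thesis by (simp add: trace_def diagm_def)
qed

text \<open>Chord against arc: the chord has length
  \<open>2 * \<bar>sin (t / 2)\<bar>\<close>.\<close>

lemma cmod_exp_minus_1_le: "cmod (exp (\<i> * of_real t) - 1) \<le> \<bar>t\<bar>"
  using dist_exp_i_1[of t] abs_sin_x_le_abs_x[of "t / 2"] by (simp add: dist_norm)

lemma abs_sin_diff_le: "\<bar>sin x - x\<bar> \<le> x\<^sup>2" for x :: real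
proof -
  have "\<bar>sin x - (\<Sum>m<2. sin_coeff m * x ^ m)\<bar> \<le> inverse (fact 2) * \<bar>x\<bar> ^ 2"
    by (rule Maclaurin_sin_bound)
  moreover have "(\<Sum>m<2. sin_coeff m * x ^ m) = x"
    by (simp add: numeral_2_eq_2 sin_coeff_def)
  ultimately have "\<bar>sin x - x\<bar> \<le> inverse 2 * x\<^sup>2" by (simp add: fact_2)
  then show ?thesis by (rule order_trans) simp
qed

lemma sum_w_norm_le:
  fixes x :: "'n::finite \<Rightarrow> 'b::real_normed_vector"
  assumes "\<And>i. norm (x i) \<le> B"
  shows "norm (\<Sum>i\<in>UNIV. w i *\<^sub>R x i) \<le> (\<Sum>i\<in>UNIV. \<bar>w i\<bar>) * B"
  unfolding sum_distrib_right
  by (rule sum_norm_le) (simp add: assms mult_left_mono)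

text \<open>In terms of the angle of \<open>z\<close>, the function \<open>l\<close> is the
  imaginary unit times the derivative of \<open>p\<close>; this explains the plus sign in
  \<open>p_first_order\<close>, as \<open>cnj x * y - 1\<close> is nearly imaginary.
  \<open>p_ge\<close> locates minimizers, \<open>l_imaginary\<close> makes gradients skew-Hermitian,
  and \<open>l_lipschitz\<close> is the derivative 2 of \<open>l\<close> at 1 in quantitative form.
  The constants 12 and 4 are the ones obtained for the geodesic potential.\<close>

locale circle_potential =
  fixes p :: "complex \<Rightarrow> real" and l :: "complex \<Rightarrow> complex"
  assumes p_continuous: "continuous_on {z. cmod z = 1} p"
    and p_1: "p 1 = 0"
    and p_ge: "cmod z = 1 \<Longrightarrow> (cmod (z - 1))\<^sup>2 \<le> p z"
    and l_1: "l 1 = 0"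
    and l_imaginary: "cmod z = 1 \<Longrightarrow> cnj (l z) = - l z"
    and p_first_order: "\<lbrakk>cmod x = 1; cmod y = 1; cmod (x - 1) \<le> 1/2; cmod (y - 1) \<le> 1/2\<rbrakk> \<Longrightarrow>
      \<bar>p y - p x + Re (l x * (cnj x * y - 1))\<bar> \<le> 12 * (cmod (x - y))\<^sup>2"
    and l_lipschitz: "\<lbrakk>cmod x = 1; cmod y = 1; cmod (x - 1) \<le> r; cmod (y - 1) \<le> r; r \<le> 1/2\<rbrakk> \<Longrightarrow>
      cmod (l x - l y - 2 * (x - y)) \<le> 4 * r * cmod (x - y)"
begin

definition \<Phi> :: "complex^'m^'m \<Rightarrow> real" where
  "\<Phi> W = Re (trace (fcalc (\<lambda>z. of_real (p z)) W))"

definition objective :: "real^'n::finite \<Rightarrow> ('n \<Rightarrow> complex^'m^'m) \<Rightarrow> complex^'m^'m \<Rightarrow> real" where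
  "objective w U V = (\<Sum>i\<in>UNIV. w $ i * \<Phi> (ctranspose V ** U i))"

text \<open>Where \<open>p_first_order\<close> applies, this is the negative of the Riemannian
  gradient of \<open>objective\<close> at \<open>V\<close>, carried to the identity by left
  multiplication with \<open>ctranspose V\<close>. Its own direction is therefore one of
  descent.\<close>

definition gradient :: "real^'n::finite \<Rightarrow> ('n \<Rightarrow> complex^'m^'m) \<Rightarrow> complex^'m^'m \<Rightarrow> complex^'m^'m" where
  "gradient w U V = (\<Sum>i\<in>UNIV. w $ i *\<^sub>R fcalc l (ctranspose V ** U i))"

lemma \<Phi>_diagonalizes:
  assumes "diagonalizes P a W"
  shows "\<Phi> W = (\<Sum>j\<in>UNIV. p (a $ j))"
  using assms by (auto simp: \<Phi>_def diagonalizes_def fcalc_conjd trace_conjd)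

lemma \<Phi>_mat_1: "\<Phi> (mat 1) = 0"
  by (simp add: \<Phi>_diagonalizes[OF diagonalizes_mat_1] p_1)

lemma \<Phi>_ge:
  assumes W: "unitary W"
  shows "(norm (W - mat 1))\<^sup>2 \<le> \<Phi> W"
proof -
  obtain P a where D: "diagonalizes P a W" using unitary_diagonalizes[OF W] by blast
  show ?thesis
    unfolding \<Phi>_diagonalizes[OF D] norm_diff_mat_1[OF D]
    by (intro sum_mono p_ge diagonalizes_cmod[OF D W])
qed

text \<open>\<open>\<Phi>\<close> descends from the continuous function \<open>(P, a) \<mapsto> \<Sum>\<^sub>j p (a\<^sub>j)\<close> along the surjection
  \<open>(P, a) \<mapsto> P diag(a) P\<^sup>*\<close>, which is closed because its domain is compact.\<close>

lemma continuous_on_\<Phi>: "continuous_on {W :: complex^'m^'m. unitary W} \<Phi>"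
  unfolding continuous_on_closed_invariant
proof (intro allI impI)
  fix B :: "real set" assume B: "closed B"
  define K where "K = {P :: complex^'m^'m. unitary P} \<times> {a :: complex^'m. \<forall>j. cmod (a $ j) = 1}"
  define q where "q x = conjd (fst x) (snd x)" for x :: "(complex^'m^'m) \<times> (complex^'m)"
  define g where "g x = (\<Sum>j\<in>UNIV. p (snd x $ j))" for x :: "(complex^'m^'m) \<times> (complex^'m)"
  have K: "compact K" unfolding K_def by (intro compact_Times compact_unitary compact_torus)
  have "continuous_on K g"
    unfolding g_def
    by (intro continuous_on_sum continuous_on_compose2[OF p_continuous] continuous_intros) (auto simp: K_def)
  then have "closed (g -` B \<inter> K)"
    using continuous_closed_preimage[OF _ compact_imp_closed[OF K] B] by (simp add: Int_commute)
  then have "compact (g -` B \<inter> K)"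
    using closed_Int_compact[of "g -` B \<inter> K", OF _ K] by (simp add: Int_assoc)
  moreover have "continuous_on (g -` B \<inter> K) q"
    unfolding q_def conjd_def by (intro continuous_intros)
  ultimately have A: "closed (q ` (g -` B \<inter> K))"
    by (intro compact_imp_closed compact_continuous_image)
  have gq: "\<Phi> (q x) = g x" "unitary (q x)" if "x \<in> K" for x
    using that \<Phi>_diagonalizes[of "fst x" "snd x" "q x"]
    by (auto simp: K_def g_def q_def diagonalizes_def unitary_conjd_iff)
  have surj: "\<exists>x\<in>K. W = q x" if "unitary W" for W
    using unitary_diagonalizes[OF that] diagonalizes_cmod[OF _ that]
    unfolding K_def q_def by (fastforce simp: diagonalizes_def)
  have eq: "q ` (g -` B \<inter> K) \<inter> {W. unitary W} = \<Phi> -` B \<inter> {W. unitary W}"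
  proof (intro set_eqI iffI)
    fix W :: "complex^'m^'m" assume "W \<in> q ` (g -` B \<inter> K) \<inter> {W. unitary W}"
    then obtain x where x: "x \<in> K" "g x \<in> B" "W = q x" by blast
    then show "W \<in> \<Phi> -` B \<inter> {W. unitary W}" using gq[OF x(1)] by simp
  next
    fix W :: "complex^'m^'m" assume W: "W \<in> \<Phi> -` B \<inter> {W. unitary W}"
    then obtain x where x: "x \<in> K" "W = q x" using surj[of W] by blast
    then have "g x \<in> B" using W gq(1)[OF x(1)] by simp
    then show "W \<in> q ` (g -` B \<inter> K) \<inter> {W. unitary W}" using x W by blast
  qed
  show "\<exists>A. closed A \<and> A \<inter> {W :: complex^'m^'m. unitary W} = \<Phi> -` B \<inter> {W. unitary W}"
    by (rule exI, rule conjI, rule A, rule eq)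
qed

lemma continuous_on_objective:
  assumes "\<And>i. unitary (U i)"
  shows "continuous_on {V. unitary V} (objective w U)"
  unfolding objective_def
  by (intro continuous_on_sum continuous_on_mult continuous_on_const
      continuous_on_compose2[OF continuous_on_\<Phi>] continuous_on_matrix_mult continuous_on_ctranspose
      continuous_on_id)
     (auto intro: unitary_mult unitary_ctranspose assms)

section \<open>Existence and location of minimizers\<close>

lemma objective_minimizer_exists:
  fixes U :: "'n::finite \<Rightarrow> complex^'m^'m"
  assumes "\<And>i. unitary (U i)"
  shows "\<exists>V. is_arg_min (objective w U) unitary V"
  using continuous_attains_inf[OF compact_unitary _ continuous_on_objective[of U w, OF assms]] unitary_mat_1
  unfolding is_arg_min_linorder by blast

text \<open>Since the weights sum to 1, replacing every \<open>U i\<close> by one \<open>U j\<close>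
  changes the objective little, uniformly in its argument. The minimizer does at least as well as
  \<open>U j\<close>, where the replaced objective is zero; so \<open>\<Phi>\<close> is small at
  \<open>ctranspose V ** U j\<close>, and it dominates the squared distance.\<close>

lemma minimizers_near:
  fixes w :: "real^'n::finite"
  assumes w: "(\<Sum>i\<in>UNIV. w $ i) = 1" and "\<epsilon> > 0"
  shows "\<exists>\<delta>>0. \<forall>(U :: 'n \<Rightarrow> complex^'m^'m) V. (\<forall>i. unitary (U i)) \<and> (\<forall>i j. norm (U i - U j) \<le> \<delta>) \<and>
    is_arg_min (objective w U) unitary V \<longrightarrow> (\<forall>i. norm (V - U i) \<le> \<epsilon>)"
proof -
  define \<Omega> where "\<Omega> = (\<Sum>i\<in>UNIV. \<bar>w $ i\<bar>)"
  have "\<Omega> \<ge> 1" using sum_abs[of "($) w" UNIV] w by (simp add: \<Omega>_def)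
  \<comment> \<open>The replacement is made at \<open>V\<close> and at \<open>U j\<close>, each time
    at cost \<open>\<Omega> * \<eta>\<close>, and twice this cost is the square of
    \<open>\<epsilon>\<close>.\<close>
  define \<eta> where "\<eta> = \<epsilon>\<^sup>2 / (2 * \<Omega>)"
  have "\<eta> > 0" using \<open>\<epsilon> > 0\<close> \<open>\<Omega> \<ge> 1\<close> by (simp add: \<eta>_def)
  have "uniformly_continuous_on {W :: complex^'m^'m. unitary W} \<Phi>"
    by (intro compact_uniformly_continuous continuous_on_\<Phi> compact_unitary)
  then obtain d where "d > 0" and d': "\<forall>W\<in>{W :: complex^'m^'m. unitary W}. \<forall>W'\<in>{W. unitary W}.
      dist W' W < d \<longrightarrow> dist (\<Phi> W') (\<Phi> W) < \<eta>"
    using \<open>\<eta> > 0\<close> unfolding uniformly_continuous_on_def by blast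
  have d: "\<bar>\<Phi> W' - \<Phi> W\<bar> < \<eta>" if "unitary W" "unitary W'" "norm (W' - W) < d" for W W' :: "complex^'m^'m"
    using d' that by (simp add: dist_norm)
  have "\<forall>i. norm (V - U i) \<le> \<epsilon>"
    if U: "\<forall>i. unitary (U i)" and close: "\<forall>i j. norm (U i - U j) \<le> d / 2"
      and V: "is_arg_min (objective w U) unitary V" for U :: "'n \<Rightarrow> complex^'m^'m" and V
  proof
    fix j
    have bnd: "\<bar>objective w U X - \<Phi> (ctranspose X ** U j)\<bar> \<le> \<Omega> * \<eta>" if X: "unitary X" for X
    proof -
      have "objective w U X - \<Phi> (ctranspose X ** U j)
          = (\<Sum>i\<in>UNIV. w $ i * (\<Phi> (ctranspose X ** U i) - \<Phi> (ctranspose X ** U j)))"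
        unfolding right_diff_distrib sum_subtractf sum_distrib_right[symmetric]
        by (simp add: objective_def w)
      also have "\<bar>\<dots>\<bar> \<le> (\<Sum>i\<in>UNIV. \<bar>w $ i\<bar> * \<eta>)"
      proof (rule order_trans[OF sum_abs], rule sum_mono)
        fix i
        have "ctranspose X ** U i - ctranspose X ** U j = ctranspose X ** (U i - U j)"
          by (simp add: matrix_diff_ldistrib)
        then have "norm (ctranspose X ** U i - ctranspose X ** U j) < d"
          using close[rule_format, of i j] \<open>d > 0\<close>
          by (simp add: norm_unitary_mult[OF unitary_ctranspose[OF X]])
        then have "\<bar>\<Phi> (ctranspose X ** U i) - \<Phi> (ctranspose X ** U j)\<bar> < \<eta>"
          using U X by (intro d unitary_mult unitary_ctranspose) auto
        then show "\<bar>w $ i * (\<Phi> (ctranspose X ** U i) - \<Phi> (ctranspose X ** U j))\<bar> \<le> \<bar>w $ i\<bar> * \<eta>"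
          by (simp add: abs_mult mult_left_mono)
      qed
      finally show ?thesis by (simp add: \<Omega>_def sum_distrib_right)
    qed
    have V': "unitary V" "objective w U V \<le> objective w U (U j)"
      using V U by (auto simp: is_arg_min_linorder)
    have "(norm (V - U j))\<^sup>2 \<le> \<Phi> (ctranspose V ** U j)"
      using \<Phi>_ge[of "ctranspose V ** U j"] U V'(1)
      by (simp add: norm_unitary_ctranspose_mult_diff unitary_mult unitary_ctranspose)
    also have "\<dots> \<le> 2 * (\<Omega> * \<eta>) + \<Phi> (ctranspose (U j) ** U j)"
      using bnd[OF V'(1)] bnd[of "U j"] U V'(2) by (auto simp: abs_le_iff)
    also have "\<dots> = \<epsilon>\<^sup>2"
    proof -
      have "ctranspose (U j) ** U j = mat 1" using U unitary_def by blast
      moreover have "2 * (\<Omega> * \<eta>) = \<epsilon>\<^sup>2" using \<open>\<Omega> \<ge> 1\<close> unfolding \<eta>_def by simp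
      ultimately show ?thesis by (simp only: \<Phi>_mat_1 add_0_right)
    qed
    finally show "norm (V - U j) \<le> \<epsilon>" by (rule power2_le_imp_le) (use \<open>\<epsilon> > 0\<close> in simp)
  qed
  then show ?thesis using \<open>d > 0\<close> by (intro exI[of _ "d/2"]) auto
qed

text \<open>Both values of \<open>\<Phi>\<close> and the trace become sums over pairs of eigenvalues
  with common weights \<open>m j k\<close>; \<open>p_first_order\<close> then bounds each pair, and
  the bounds add up to the squared norm.\<close>

lemma \<Phi>_first_order:
  fixes W W' :: "complex^'m^'m"
  assumes W: "unitary W" and W': "unitary W'"
    and near: "norm (W - mat 1) \<le> 1/2" "norm (W' - mat 1) \<le> 1/2"
  shows "\<bar>\<Phi> W' - \<Phi> W + Re (trace (fcalc l W ** (ctranspose W ** W' - mat 1)))\<bar> \<le> 12 * (norm (W - W'))\<^sup>2"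
proof -
  obtain P a where D: "diagonalizes P a W" using unitary_diagonalizes[OF W] by blast
  obtain Q b where E: "diagonalizes Q b W'" using unitary_diagonalizes[OF W'] by blast
  have P: "unitary P" "W = conjd P a" and Q: "unitary Q" "W' = conjd Q b"
    using D E by (auto simp: diagonalizes_def)
  define m where "m j k = (cmod ((ctranspose P ** Q) $ j $ k))\<^sup>2" for j k
  have m: "(\<Sum>k\<in>UNIV. m j k) = 1" "(\<Sum>j\<in>UNIV. m j k) = 1" for j k
    unfolding m_def by (rule unitary_diag_weights[OF P(1) Q(1)])+
  have "\<Phi> W' = (\<Sum>k\<in>UNIV. \<Sum>j\<in>UNIV. p (b $ k) * m j k)"
    by (simp add: \<Phi>_diagonalizes[OF E] m flip: sum_distrib_left)
  then have 1: "\<Phi> W' = (\<Sum>j\<in>UNIV. \<Sum>k\<in>UNIV. p (b $ k) * m j k)"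
    by (subst sum.swap)
  have 2: "\<Phi> W = (\<Sum>j\<in>UNIV. \<Sum>k\<in>UNIV. p (a $ j) * m j k)"
    by (simp add: \<Phi>_diagonalizes[OF D] m flip: sum_distrib_left)
  have fl: "fcalc l W = conjd P (\<chi> j. l (a $ j))" by (rule fcalc_diagonalizes[OF D])
  \<comment> \<open>Here \<open>mat 1\<close> is written as diagonalized by \<open>Q\<close>, so
    that \<open>trace_conjd_mult\<close> produces the same weights for it.\<close>
  have "fcalc l W ** (ctranspose W ** W' - mat 1)
      = conjd P (\<chi> j. l (a $ j) * cnj (a $ j)) ** conjd Q b - conjd P (\<chi> j. l (a $ j)) ** conjd Q (\<chi> k. 1)"
    unfolding fl unfolding P(2) Q(2)
    by (simp add: matrix_diff_ldistrib conjd_one[OF Q(1)] ctranspose_conjd conjd_mult[OF P(1)] matrix_mul_assoc)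
  then have 3: "trace (fcalc l W ** (ctranspose W ** W' - mat 1))
      = (\<Sum>j\<in>UNIV. \<Sum>k\<in>UNIV. l (a $ j) * (cnj (a $ j) * b $ k - 1) * of_real (m j k))"
    by (simp only: trace_sub trace_conjd_mult[OF P(1) Q(1)])
       (simp add: m_def algebra_simps flip: sum_subtractf)
  have "\<Phi> W' - \<Phi> W + Re (trace (fcalc l W ** (ctranspose W ** W' - mat 1)))
      = (\<Sum>j\<in>UNIV. \<Sum>k\<in>UNIV. (p (b $ k) - p (a $ j) + Re (l (a $ j) * (cnj (a $ j) * b $ k - 1))) * m j k)"
    unfolding 1 2 3 by (simp add: left_diff_distrib distrib_right sum_subtractf sum.distrib)
  also have "\<bar>\<dots>\<bar> \<le> (\<Sum>j\<in>UNIV. \<Sum>k\<in>UNIV. 12 * ((cmod (a $ j - b $ k))\<^sup>2 * m j k))"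
  proof (intro order_trans[OF sum_abs] sum_mono)
    fix j k
    have "\<bar>p (b $ k) - p (a $ j) + Re (l (a $ j) * (cnj (a $ j) * b $ k - 1))\<bar> \<le> 12 * (cmod (a $ j - b $ k))\<^sup>2"
      using near spectrum_diff_mat_1[OF D, of j] spectrum_diff_mat_1[OF E, of k]
      by (intro p_first_order diagonalizes_cmod[OF D W] diagonalizes_cmod[OF E W']) auto
    then show "\<bar>(p (b $ k) - p (a $ j) + Re (l (a $ j) * (cnj (a $ j) * b $ k - 1))) * m j k\<bar>
        \<le> 12 * ((cmod (a $ j - b $ k))\<^sup>2 * m j k)"
      by (simp add: abs_mult m_def mult_right_mono flip: mult.assoc)
  qed
  also have "\<dots> = 12 * (norm (W - W'))\<^sup>2"
    unfolding P(2) Q(2) norm_conjd_diff[OF P(1) Q(1)] m_def by (simp add: sum_distrib_left)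
  finally show ?thesis .
qed

text \<open>\<open>fcalc_lipschitz\<close> for the scalar function \<open>l z - 2 * z\<close>,
  compared with the identity function.\<close>

lemma fcalc_l_lipschitz:
  fixes W W' :: "complex^'m^'m"
  assumes W: "unitary W" and W': "unitary W'" and "r \<le> 1/2"
    and near: "norm (W - mat 1) \<le> r" "norm (W' - mat 1) \<le> r"
  shows "norm (fcalc l W - fcalc l W' - 2 *\<^sub>R (W - W')) \<le> 4 * r * norm (W - W')"
proof -
  obtain P a where D: "diagonalizes P a W" using unitary_diagonalizes[OF W] by blast
  obtain Q b where E: "diagonalizes Q b W'" using unitary_diagonalizes[OF W'] by blast
  have "0 \<le> r" using near(1) norm_ge_zero order_trans by blast
  have "norm (fcalc (\<lambda>z. l z - 2 * z) W - fcalc (\<lambda>z. l z - 2 * z) W')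
      \<le> 4 * r * norm (fcalc (\<lambda>z. z) W - fcalc (\<lambda>z. z) W')"
  proof (rule fcalc_lipschitz[OF D E])
    fix j k
    have "cmod (l (a $ j) - l (b $ k) - 2 * (a $ j - b $ k)) \<le> 4 * r * cmod (a $ j - b $ k)"
      using near spectrum_diff_mat_1[OF D, of j] spectrum_diff_mat_1[OF E, of k]
      by (intro l_lipschitz diagonalizes_cmod[OF D W] diagonalizes_cmod[OF E W'] \<open>r \<le> 1/2\<close>) auto
    then show "cmod (l (a $ j) - 2 * a $ j - (l (b $ k) - 2 * b $ k)) \<le> 4 * r * cmod (a $ j - b $ k)"
      by (simp add: algebra_simps)
  qed (simp add: \<open>0 \<le> r\<close>)
  moreover have "fcalc (\<lambda>z. l z - 2 * z) W = fcalc l W - 2 *\<^sub>R W"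
    by (simp only: fcalc_diff[OF D] fcalc_cmult_two[OF D] fcalc_id[OF D])
  moreover have "fcalc (\<lambda>z. l z - 2 * z) W' = fcalc l W' - 2 *\<^sub>R W'"
    by (simp only: fcalc_diff[OF E] fcalc_cmult_two[OF E] fcalc_id[OF E])
  moreover have "fcalc l W - fcalc l W' - 2 *\<^sub>R (W - W') = (fcalc l W - 2 *\<^sub>R W) - (fcalc l W' - 2 *\<^sub>R W')"
    by (simp add: algebra_simps)
  ultimately show ?thesis
    by (simp only: fcalc_id[OF D] fcalc_id[OF E])
qed

text \<open>The test curve is \<open>V exp(s Y)\<close> with \<open>Y\<close> the gradient itself, which is skew-Hermitian.\<close>

lemma minimizer_gradient:
  fixes U :: "'n::finite \<Rightarrow> complex^'m^'m"
  assumes U: "\<And>i. unitary (U i)" and near: "\<And>i. norm (V - U i) \<le> 1/4"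
    and min: "is_arg_min (objective w U) unitary V"
  shows "gradient w U V = 0"
proof (rule ccontr)
  define Y where "Y = gradient w U V"
  assume "gradient w U V \<noteq> 0"
  then have Y0: "norm Y > 0" by (simp add: Y_def)
  have V: "unitary V" using min by (simp add: is_arg_min_linorder)
  define W where "W i = ctranspose V ** U i" for i
  have W: "unitary (W i)" for i unfolding W_def by (intro unitary_mult unitary_ctranspose U V)
  have W1: "norm (W i - mat 1) \<le> 1/4" for i
    using near[of i] by (simp add: W_def norm_unitary_ctranspose_mult_diff[OF V])
  have YW: "Y = (\<Sum>i\<in>UNIV. w $ i *\<^sub>R fcalc l (W i))"
    by (simp add: Y_def gradient_def W_def)
  have sk: "ctranspose (fcalc l (W i)) = - fcalc l (W i)" for i
  proof -
    obtain P a where D: "diagonalizes P a (W i)" using unitary_diagonalizes[OF W] by blast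
    have "(\<chi> j. cnj (l (a $ j))) = - (\<chi> j. l (a $ j))"
      by (simp add: vec_eq_iff l_imaginary diagonalizes_cmod[OF D W])
    then show ?thesis
      by (simp add: fcalc_diagonalizes[OF D] ctranspose_conjd
          linear_neg[OF bounded_linear.linear[OF bounded_linear_conjd]])
  qed
  have skY: "ctranspose Y = - Y"
    by (simp add: YW ctranspose_sum ctranspose_scaleR sk sum_negf)
  then obtain P y where D: "diagonalizes P y Y"
    using normal_diagonalizes[of Y] by (auto simp: matrix_minus_left matrix_minus_right)
  then have P: "unitary P" and Yy: "Y = conjd P y" by (auto simp: diagonalizes_def)
  define \<eta> where "\<eta> j = Im (y $ j)" for j
  have y: "y $ j = \<i> * of_real (\<eta> j)" for j
  proof -
    have "conjd P ((\<chi> i. cnj (y $ i)) - - y) = 0"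
      using skY unfolding Yy conjd_diff
      by (simp add: ctranspose_conjd linear_neg[OF bounded_linear.linear[OF bounded_linear_conjd]])
    then have "(norm (conjd P ((\<chi> i. cnj (y $ i)) - - y)))\<^sup>2 = 0" by simp
    then have "cnj (y $ j) + y $ j = 0"
      unfolding norm_conjd[OF P] by (simp add: sum_nonneg_eq_0_iff)
    then show ?thesis by (simp add: complex_eq_iff \<eta>_def)
  qed
  have nY: "(norm Y)\<^sup>2 = (\<Sum>j\<in>UNIV. (\<eta> j)\<^sup>2)"
    unfolding Yy norm_conjd[OF P] by (simp add: y norm_mult)
  have \<eta>_le: "\<bar>\<eta> j\<bar> \<le> norm Y" for j
  proof -
    have "(\<eta> j)\<^sup>2 \<le> (norm Y)\<^sup>2" unfolding nY by (rule member_le_sum) auto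
    then show ?thesis using abs_le_square_iff[of "\<eta> j" "norm Y"] by simp
  qed
  define \<Omega> where "\<Omega> = (\<Sum>i\<in>UNIV. \<bar>w $ i\<bar>)"
  have "\<Omega> \<ge> 0" by (simp add: \<Omega>_def sum_nonneg)
  \<comment> \<open>The step length is such that the two relative errors, \<open>s * norm Y\<close>
    from replacing the sine by its argument and \<open>s * (12 * \<Omega>)\<close> from the
    quadratic remainders, add up to less than 1.\<close>
  define s where "s = 1 / (4 * (norm Y + 12 * \<Omega>))"
  have s: "s > 0" "s * norm Y + s * (12 * \<Omega>) \<le> 1/4"
  proof -
    have K: "norm Y + 12 * \<Omega> > 0" using Y0 \<open>\<Omega> \<ge> 0\<close> by linarith
    then show "s > 0" by (simp add: s_def)
    have "s * norm Y + s * (12 * \<Omega>) = s * (norm Y + 12 * \<Omega>)" by (rule distrib_left[symmetric])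
    also have "\<dots> = 1/4" using K by (simp add: s_def)
    finally show "s * norm Y + s * (12 * \<Omega>) \<le> 1/4" by simp
  qed
  \<comment> \<open>Added to the distance 1/4 of \<open>W i\<close> from the identity, this keeps
    the perturbed matrix within 1/2, the range of \<open>p_first_order\<close>.\<close>
  have sY: "s * norm Y \<le> 1/4"
    using s \<open>\<Omega> \<ge> 0\<close> mult_nonneg_nonneg[of s "12 * \<Omega>"] by linarith
  define q where "q = (\<chi> j. exp (\<i> * of_real (s * \<eta> j)))"
  define Q where "Q = conjd P q"
  have Q: "unitary Q" unfolding Q_def unitary_conjd_iff[OF P] q_def by simp
  have Qs: "ctranspose Q = conjd P (\<chi> j. cnj (q $ j))" by (simp add: Q_def ctranspose_conjd)
  have cq: "cnj (q $ j) = exp (\<i> * of_real (- (s * \<eta> j)))" for j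
    by (simp add: q_def exp_cnj)
  have dq: "ctranspose Q - mat 1 = conjd P ((\<chi> j. cnj (q $ j)) - (\<chi> j. 1))"
    by (simp add: Qs conjd_diff conjd_one[OF P])
  have "(norm (ctranspose Q - mat 1))\<^sup>2 \<le> (\<Sum>j\<in>UNIV. (s * \<eta> j)\<^sup>2)"
    unfolding dq norm_conjd[OF P]
  proof (rule sum_mono)
    fix j
    have "(cmod (cnj (q $ j) - 1))\<^sup>2 \<le> \<bar>- (s * \<eta> j)\<bar>\<^sup>2"
      unfolding cq by (intro power_mono cmod_exp_minus_1_le) simp
    then show "(cmod (((\<chi> j. cnj (q $ j)) - (\<chi> j. 1)) $ j))\<^sup>2 \<le> (s * \<eta> j)\<^sup>2" by simp
  qed
  also have "\<dots> = (s * norm Y)\<^sup>2" by (simp add: power_mult_distrib nY sum_distrib_left)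
  finally have nQ2: "(norm (ctranspose Q - mat 1))\<^sup>2 \<le> (s * norm Y)\<^sup>2" .
  then have nQ: "norm (ctranspose Q - mat 1) \<le> s * norm Y"
    by (rule power2_le_imp_le) (use s(1) in simp)
  have step: "\<bar>\<Phi> (ctranspose Q ** W i) - \<Phi> (W i) + Re (trace (fcalc l (W i) ** (ctranspose Q - mat 1)))\<bar>
      \<le> 12 * (s * norm Y)\<^sup>2" for i
  proof -
    obtain R a where Da: "diagonalizes R a (W i)" using unitary_diagonalizes[OF W] by blast
    have W': "unitary (ctranspose Q ** W i)" by (intro unitary_mult unitary_ctranspose Q W)
    have diff: "ctranspose Q ** W i - W i = (ctranspose Q - mat 1) ** W i"
      by (simp add: matrix_diff_rdistrib)
    have nd: "norm (W i - ctranspose Q ** W i) = norm (ctranspose Q - mat 1)"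
      using norm_mult_unitary[OF W, of "ctranspose Q - mat 1" i] by (metis diff norm_minus_commute)
    have near': "norm (ctranspose Q ** W i - mat 1) \<le> 1/2"
      using norm_triangle_ineq[of "ctranspose Q ** W i - W i" "W i - mat 1"] nQ sY W1[of i] nd
      by (simp add: norm_minus_commute)
    \<comment> \<open>The first-order term contains \<open>ctranspose Q\<close> conjugated by
      \<open>W i\<close>. As \<open>W i\<close> commutes with \<open>fcalc l (W i)\<close>,
      cyclicity of the trace removes the conjugation, and the same perturbation
      \<open>ctranspose Q - mat 1\<close> appears for every \<open>i\<close>.\<close>
    have "trace (fcalc l (W i) ** (ctranspose (W i) ** (ctranspose Q ** W i)))
        = trace ((fcalc l (W i) ** ctranspose (W i) ** ctranspose Q) ** W i)"
      by (simp add: matrix_mul_assoc)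
    also have "\<dots> = trace (W i ** fcalc l (W i) ** ctranspose (W i) ** ctranspose Q)"
      by (subst trace_mul_sym) (simp add: matrix_mul_assoc)
    also have "W i ** fcalc l (W i) = fcalc l (W i) ** W i"
      using fcalc_commute[OF Da, of "\<lambda>z. z" l] by (simp add: fcalc_id[OF Da])
    also have "fcalc l (W i) ** W i ** ctranspose (W i) = fcalc l (W i)"
      by (rule unitary_cancel(3)[OF W])
    finally have "trace (fcalc l (W i) ** (ctranspose (W i) ** (ctranspose Q ** W i) - mat 1))
        = trace (fcalc l (W i) ** (ctranspose Q - mat 1))"
      by (simp add: matrix_diff_ldistrib trace_sub)
    moreover have "norm (W i - mat 1) \<le> 1/2" using W1[of i] by simp
    ultimately have "\<bar>\<Phi> (ctranspose Q ** W i) - \<Phi> (W i) + Re (trace (fcalc l (W i) ** (ctranspose Q - mat 1)))\<bar>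
        \<le> 12 * (norm (ctranspose Q - mat 1))\<^sup>2"
      using \<Phi>_first_order[OF W[of i] W' _ near'] by (simp add: nd)
    then show ?thesis using nQ2 by linarith
  qed
  have VQ: "unitary (V ** Q)" by (intro unitary_mult V Q)
  have obj: "objective w U (V ** Q) = (\<Sum>i\<in>UNIV. w $ i * \<Phi> (ctranspose Q ** W i))"
    by (simp add: objective_def W_def ctranspose_mult matrix_mul_assoc)
  have objV: "objective w U V = (\<Sum>i\<in>UNIV. w $ i * \<Phi> (W i))"
    by (simp add: objective_def W_def)
  have "Re (trace (Y ** (ctranspose Q - mat 1)))
      = (\<Sum>i\<in>UNIV. w $ i * Re (trace (fcalc l (W i) ** (ctranspose Q - mat 1))))"
    unfolding YW by (simp add: matrix_sum_left matrix_scaleR_left trace_sum trace_scaleR)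
  then have "objective w U (V ** Q) - objective w U V + Re (trace (Y ** (ctranspose Q - mat 1)))
     = (\<Sum>i\<in>UNIV. w $ i *\<^sub>R (\<Phi> (ctranspose Q ** W i) - \<Phi> (W i) + Re (trace (fcalc l (W i) ** (ctranspose Q - mat 1)))))"
    unfolding obj objV by (simp add: distrib_left right_diff_distrib sum.distrib sum_subtractf)
  also have "\<bar>\<dots>\<bar> \<le> \<Omega> * (12 * (s * norm Y)\<^sup>2)"
    unfolding \<Omega>_def by (rule sum_w_norm_le[where 'b=real, unfolded real_norm_def]) (rule step)
  finally have upper: "objective w U (V ** Q) - objective w U V + Re (trace (Y ** (ctranspose Q - mat 1)))
      \<le> \<Omega> * (12 * (s * norm Y)\<^sup>2)" by simp
  have "trace (Y ** (ctranspose Q - mat 1)) = (\<Sum>j\<in>UNIV. y $ j * (cnj (q $ j) - 1))"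
    unfolding dq Yy conjd_mult[OF P] trace_conjd[OF P] by simp
  also have "Re \<dots> = (\<Sum>j\<in>UNIV. \<eta> j * sin (s * \<eta> j))"
    by (simp add: cq y Re_exp Im_exp)
  \<comment> \<open>Replacing the sine by its argument gives \<open>s\<close> times the square of
    \<open>\<eta> j\<close>, and the quadratic error is controlled by the bound
    \<open>norm Y\<close> on \<open>\<bar>\<eta> j\<bar>\<close>.\<close>
  also have "\<dots> \<ge> (\<Sum>j\<in>UNIV. (s * (1 - s * norm Y)) * (\<eta> j)\<^sup>2)"
  proof (rule sum_mono)
    fix j
    have "\<bar>\<eta> j\<bar> * \<bar>sin (s * \<eta> j) - s * \<eta> j\<bar> \<le> norm Y * (s * \<eta> j)\<^sup>2"
      by (intro mult_mono \<eta>_le abs_sin_diff_le) auto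
    then have "\<bar>\<eta> j * (sin (s * \<eta> j) - s * \<eta> j)\<bar> \<le> norm Y * (s * \<eta> j)\<^sup>2"
      by (simp add: abs_mult)
    then have "\<eta> j * (s * \<eta> j) - norm Y * (s * \<eta> j)\<^sup>2 \<le> \<eta> j * sin (s * \<eta> j)"
      by (simp add: abs_le_iff right_diff_distrib)
    then show "s * (1 - s * norm Y) * (\<eta> j)\<^sup>2 \<le> \<eta> j * sin (s * \<eta> j)"
      by (simp add: power2_eq_square algebra_simps)
  qed
  finally have lower: "s * (1 - s * norm Y) * (norm Y)\<^sup>2 \<le> Re (trace (Y ** (ctranspose Q - mat 1)))"
    by (simp add: nY sum_distrib_left)
  have "0 \<le> objective w U (V ** Q) - objective w U V"
    using min VQ by (simp add: is_arg_min_linorder)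
  then have "s * (1 - s * norm Y) * (norm Y)\<^sup>2 \<le> \<Omega> * (12 * (s * norm Y)\<^sup>2)"
    using upper lower by linarith
  then have "(s * (norm Y)\<^sup>2) * (1 - s * norm Y - s * (12 * \<Omega>)) \<le> 0"
    by (simp add: power2_eq_square algebra_simps)
  moreover have "(s * (norm Y)\<^sup>2) * (1 - s * norm Y - s * (12 * \<Omega>)) > 0"
    using s Y0 by (intro mult_pos_pos) auto
  ultimately show False by simp
qed

text \<open>Near the identity \<open>l\<close> is close to multiplication by 2, and every
  \<open>U i\<close> is close to \<open>V\<close>. So the difference of the gradients is close to
  twice \<open>ctranspose (V - V') ** V\<close>, whose norm is that of \<open>V - V'\<close>. The
  two approximations cost \<open>4 * r * \<Omega>\<close> and \<open>2 * r * \<Omega>\<close> times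
  that norm; the bound 1/6 makes the sum at most one of the two copies.\<close>

lemma gradient_expanding:
  fixes U :: "'n::finite \<Rightarrow> complex^'m^'m" and w :: "real^'n"
  assumes U: "\<And>i. unitary (U i)" and V: "unitary V" "unitary V'"
    and w: "(\<Sum>i\<in>UNIV. w $ i) = 1"
    and r: "r \<le> 1/2" "r * (\<Sum>i\<in>UNIV. \<bar>w $ i\<bar>) \<le> 1/6"
    and near: "\<And>i. norm (V - U i) \<le> r" "\<And>i. norm (V' - U i) \<le> r"
  shows "norm (V - V') \<le> norm (gradient w U V - gradient w U V')"
proof -
  define \<Omega> where "\<Omega> = (\<Sum>i\<in>UNIV. \<bar>w $ i\<bar>)"
  define D where "D = norm (V - V')"
  define W where "W i = ctranspose V ** U i" for i
  define W' where "W' i = ctranspose V' ** U i" for i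
  have un: "unitary (W i)" "unitary (W' i)" for i
    unfolding W_def W'_def by (intro unitary_mult unitary_ctranspose U V)+
  have W1: "norm (W i - mat 1) \<le> r" "norm (W' i - mat 1) \<le> r" for i
    using near[of i] by (simp_all add: W_def W'_def norm_unitary_ctranspose_mult_diff V)
  have WW: "W i - W' i = ctranspose (V - V') ** U i" for i
    by (simp add: W_def W'_def ctranspose_diff matrix_diff_rdistrib)
  have nW: "norm (W i - W' i) = D" for i
    by (simp add: WW norm_mult_unitary[OF U] D_def)
  have "norm (\<Sum>i\<in>UNIV. w $ i *\<^sub>R (fcalc l (W i) - fcalc l (W' i) - 2 *\<^sub>R (W i - W' i))) \<le> \<Omega> * (4 * r * D)"
    unfolding \<Omega>_def
  proof (rule sum_w_norm_le)
    fix i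
    show "norm (fcalc l (W i) - fcalc l (W' i) - 2 *\<^sub>R (W i - W' i)) \<le> 4 * r * D"
      using fcalc_l_lipschitz[OF un(1)[of i] un(2)[of i] r(1) W1(1) W1(2)] by (simp add: nW)
  qed
  also have "(\<Sum>i\<in>UNIV. w $ i *\<^sub>R (fcalc l (W i) - fcalc l (W' i) - 2 *\<^sub>R (W i - W' i)))
      = gradient w U V - gradient w U V' - 2 *\<^sub>R (\<Sum>i\<in>UNIV. w $ i *\<^sub>R (W i - W' i))"
    by (simp add: gradient_def W_def W'_def scaleR_diff_right sum_subtractf scaleR_sum_right mult.commute)
  finally have 1: "norm (gradient w U V - gradient w U V' - 2 *\<^sub>R (\<Sum>i\<in>UNIV. w $ i *\<^sub>R (W i - W' i))) \<le> \<Omega> * (4 * r * D)" .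
  \<comment> \<open>Each \<open>U i\<close> is written as \<open>V - (V - U i)\<close>; the weights
    sum to 1, so the main term no longer depends on \<open>i\<close>.\<close>
  have "(\<Sum>i\<in>UNIV. w $ i *\<^sub>R (W i - W' i))
      = (\<Sum>i\<in>UNIV. w $ i *\<^sub>R (ctranspose (V - V') ** V - ctranspose (V - V') ** (V - U i)))"
    by (simp add: WW matrix_diff_ldistrib)
  also have "\<dots> = ctranspose (V - V') ** V - (\<Sum>i\<in>UNIV. w $ i *\<^sub>R (ctranspose (V - V') ** (V - U i)))"
    by (simp add: scaleR_diff_right sum_subtractf w flip: scaleR_left.sum)
  finally have 2: "(\<Sum>i\<in>UNIV. w $ i *\<^sub>R (W i - W' i))
      = ctranspose (V - V') ** V - (\<Sum>i\<in>UNIV. w $ i *\<^sub>R (ctranspose (V - V') ** (V - U i)))" .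
  have "norm (\<Sum>i\<in>UNIV. w $ i *\<^sub>R (ctranspose (V - V') ** (V - U i))) \<le> \<Omega> * (D * r)"
    unfolding \<Omega>_def
  proof (rule sum_w_norm_le)
    fix i
    have "norm (ctranspose (V - V') ** (V - U i)) \<le> norm (ctranspose (V - V')) * norm (V - U i)"
      by (rule norm_matrix_mult)
    also have "\<dots> \<le> D * r" unfolding D_def norm_ctranspose by (intro mult_left_mono near) simp
    finally show "norm (ctranspose (V - V') ** (V - U i)) \<le> D * r" .
  qed
  moreover have "norm (ctranspose (V - V') ** V) = D"
    by (simp add: norm_mult_unitary[OF V(1)] D_def)
  ultimately have 3: "D - \<Omega> * (D * r) \<le> norm (\<Sum>i\<in>UNIV. w $ i *\<^sub>R (W i - W' i))"
    unfolding 2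
    using norm_triangle_ineq2[of "ctranspose (V - V') ** V" "\<Sum>i\<in>UNIV. w $ i *\<^sub>R (ctranspose (V - V') ** (V - U i))"]
    by linarith
  have "2 * (D - \<Omega> * (D * r)) - \<Omega> * (4 * r * D) \<le> norm (gradient w U V - gradient w U V')"
  proof -
    define S where "S = (\<Sum>i\<in>UNIV. w $ i *\<^sub>R (W i - W' i))"
    have "norm (2 *\<^sub>R S) \<le> norm (gradient w U V - gradient w U V') + norm (gradient w U V - gradient w U V' - 2 *\<^sub>R S)"
      using norm_triangle_sub[of "2 *\<^sub>R S" "gradient w U V - gradient w U V'"] by (simp only: norm_minus_commute)
    moreover have "norm (2 *\<^sub>R S) = 2 * norm S" by simp
    moreover have "2 * d - y \<le> n" if "x \<le> n + e" "x = 2 * z" "e \<le> y" "d \<le> z" for x n e z y d :: real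
      using that by linarith
    ultimately show ?thesis using 1 3 unfolding S_def[symmetric] by blast
  qed
  moreover have "6 * (r * \<Omega>) * D \<le> 1 * D"
    using r(2) by (intro mult_right_mono) (auto simp: \<Omega>_def D_def)
  ultimately show ?thesis unfolding D_def[symmetric] by (simp add: algebra_simps)
qed

text \<open>Comparison with the identity, where \<open>l\<close> vanishes: each term is at most
  \<open>2 * r + 4 * r * r\<close>, and \<open>r \<le> 1/2\<close>.\<close>

lemma norm_gradient_le:
  fixes U :: "'n::finite \<Rightarrow> complex^'m^'m" and w :: "real^'n"
  assumes U: "\<And>i. unitary (U i)" and V: "unitary V" and near: "\<And>i. norm (V - U i) \<le> r" and r: "r \<le> 1/2"
  shows "norm (gradient w U V) \<le> (\<Sum>i\<in>UNIV. \<bar>w $ i\<bar>) * (4 * r)"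
  unfolding gradient_def
proof (rule sum_w_norm_le)
  fix i
  define W where "W = ctranspose V ** U i"
  have W: "unitary W" unfolding W_def by (intro unitary_mult unitary_ctranspose U V)
  have W1: "norm (W - mat 1) \<le> r"
    using near[of i] by (simp add: W_def norm_unitary_ctranspose_mult_diff V)
  then have "0 \<le> r" using norm_ge_zero order_trans by blast
  have "norm (fcalc l W - fcalc l (mat 1) - 2 *\<^sub>R (W - mat 1)) \<le> 4 * r * norm (W - mat 1)"
    by (rule fcalc_l_lipschitz[OF W unitary_mat_1 r W1]) (simp add: \<open>0 \<le> r\<close>)
  moreover have l0: "fcalc l (mat 1) = 0"
    using norm_fcalc[OF diagonalizes_mat_1, of l] by (simp add: l_1)
  moreover have "4 * r * norm (W - mat 1) \<le> 2 * norm (W - mat 1)"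
    using r by (intro mult_right_mono) auto
  ultimately have "norm (fcalc l W - 2 *\<^sub>R (W - mat 1)) \<le> 2 * norm (W - mat 1)"
    unfolding l0 diff_0_right by linarith
  then have "norm (fcalc l W) \<le> 4 * r"
    using norm_triangle_ineq2[of "fcalc l W" "2 *\<^sub>R (W - mat 1)"] W1 unfolding norm_scaleR by linarith
  then show "norm (fcalc l (ctranspose V ** U i)) \<le> 4 * r" by (simp add: W_def)
qed

text \<open>Compactness gives only the fixed radius \<open>r\<close>; inside it the expansion of the
  gradient yields uniqueness and a bound linear in \<open>s\<close>. The equivalence form of
  uniqueness later determines the value selected by \<open>arg_min\<close>.\<close>

theorem unique_minimizer:
  fixes w :: "real^'n::finite"
  assumes w: "(\<Sum>i\<in>UNIV. w $ i) = 1" and r: "0 < r" "r \<le> 1/4" "r * (\<Sum>i\<in>UNIV. \<bar>w $ i\<bar>) \<le> 1/6"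
  shows "\<exists>\<delta>>0. \<forall>(U :: 'n \<Rightarrow> complex^'m^'m) s. (\<forall>i. unitary (U i)) \<and> s \<le> \<delta> \<and> (\<forall>i j. norm (U i - U j) \<le> s) \<longrightarrow>
    (\<exists>V. (\<forall>V'. is_arg_min (objective w U) unitary V' \<longleftrightarrow> V' = V) \<and> unitary V \<and> gradient w U V = 0 \<and>
      (\<forall>i. norm (V - U i) \<le> min r ((\<Sum>i\<in>UNIV. \<bar>w $ i\<bar>) * (4 * s))))"
proof -
  obtain d where d: "d > 0" and near: "\<And>(U :: 'n \<Rightarrow> complex^'m^'m) V. (\<forall>i. unitary (U i)) \<and> (\<forall>i j. norm (U i - U j) \<le> d) \<and>
      is_arg_min (objective w U) unitary V \<Longrightarrow> \<forall>i. norm (V - U i) \<le> r"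
    using minimizers_near[OF w r(1)] by metis
  have "\<exists>V. (\<forall>V'. is_arg_min (objective w U) unitary V' \<longleftrightarrow> V' = V) \<and> unitary V \<and> gradient w U V = 0 \<and>
      (\<forall>i. norm (V - U i) \<le> min r ((\<Sum>i\<in>UNIV. \<bar>w $ i\<bar>) * (4 * s)))"
    if U: "\<And>i. unitary (U i)" and s: "s \<le> min d r" and close: "\<And>i j. norm (U i - U j) \<le> s"
    for U :: "'n \<Rightarrow> complex^'m^'m" and s
  proof -
    have min: "unitary V" "\<And>i. norm (V - U i) \<le> r" "gradient w U V = 0"
      if V: "is_arg_min (objective w U) unitary V" for V
    proof -
      show "unitary V" using V by (simp add: is_arg_min_linorder)
      have "norm (U i - U j) \<le> d" for i j using close[of i j] s by linarith
      then show n: "norm (V - U i) \<le> r" for i using near[of U V] U V by blast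
      have "norm (V - U i) \<le> 1/4" for i using n[of i] r(2) by linarith
      then show "gradient w U V = 0" by (rule minimizer_gradient[OF U _ V])
    qed
    obtain V where V: "is_arg_min (objective w U) unitary V" using objective_minimizer_exists[of U w] U by blast
    have uniq: "V' = V" if V': "is_arg_min (objective w U) unitary V'" for V'
    proof -
      have "norm (V' - V) \<le> norm (gradient w U V' - gradient w U V)"
        by (rule gradient_expanding[where r = r, OF _ min(1)[OF V'] min(1)[OF V] w _ r(3)])
          (use U r(2) min(2)[OF V] min(2)[OF V'] in auto)
      then show ?thesis using min(3)[OF V] min(3)[OF V'] by simp
    qed
    have bound: "norm (V - U i) \<le> (\<Sum>i\<in>UNIV. \<bar>w $ i\<bar>) * (4 * s)" for i
    proof -
      \<comment> \<open>Because \<open>s \<le> r\<close>, the datum \<open>U i\<close> is itself an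
        admissible comparison point for the expansion; its gradient is of order
        \<open>s\<close>.\<close>
      have near_i: "norm (U i - U j) \<le> r" for j using close[of i j] s by linarith
      have "norm (V - U i) \<le> norm (gradient w U V - gradient w U (U i))"
        by (rule gradient_expanding[where r = r, OF _ min(1)[OF V] U[of i] w _ r(3)])
          (use U r(2) min(2)[OF V] near_i in auto)
      also have "\<dots> = norm (gradient w U (U i))" using min(3)[OF V] by simp
      also have "\<dots> \<le> (\<Sum>i\<in>UNIV. \<bar>w $ i\<bar>) * (4 * s)"
        using s r(2) by (intro norm_gradient_le U close) auto
      finally show ?thesis .
    qed
    show ?thesis
    proof (intro exI[of _ V] conjI allI iffI)
      show "is_arg_min (objective w U) unitary V'" if "V' = V" for V' using V that by simp
      show "norm (V - U i) \<le> min r ((\<Sum>i\<in>UNIV. \<bar>w $ i\<bar>) * (4 * s))" for i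
        using min(2)[OF V] bound[of i] by simp
    qed (rule uniq min(1)[OF V] min(3)[OF V], assumption?)+
  qed
  moreover have "min d r > 0" using d r(1) by simp
  ultimately show ?thesis by blast
qed

end

section \<open>The chordal and the geodesic potential\<close>

lemma cmod_diff_1_power2: "cmod z = 1 \<Longrightarrow> (cmod (z - 1))\<^sup>2 = 2 - 2 * Re z"
  using cmod_power2[of z] cmod_power2[of "z - 1"] by (simp add: power2_eq_square algebra_simps)

interpretation chordal: circle_potential "\<lambda>z. (cmod (z - 1))\<^sup>2" "\<lambda>z. z - cnj z"
proof
  show "continuous_on {z. cmod z = 1} (\<lambda>z. (cmod (z - 1))\<^sup>2)" by (intro continuous_intros)
next
  fix x y :: complex assume xy: "cmod x = 1" "cmod y = 1"
  obtain a b c d where abcd: "x = Complex a b" "y = Complex c d" by (meson complex.exhaust)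
  have x: "a\<^sup>2 + b\<^sup>2 = 1" and y: "c\<^sup>2 + d\<^sup>2 = 1"
    using xy cmod_power2[of x] cmod_power2[of y] by (simp_all add: abcd)
  have "(cmod (x - y))\<^sup>2 = (a - c)\<^sup>2 + (b - d)\<^sup>2"
    by (simp only: cmod_power2) (simp add: abcd)
  then have "(cmod (x - y))\<^sup>2 = 2 - 2 * (a * c + b * d)"
    using x y by (simp add: power2_diff algebra_simps)
  \<comment> \<open>The remainder is exactly \<open>Re x\<close> times the squared chord: the
    addition theorem for the cosine in Cartesian coordinates.\<close>
  moreover have "(cmod (y - 1))\<^sup>2 - (cmod (x - 1))\<^sup>2 + Re ((x - cnj x) * (cnj x * y - 1))
      = a * (2 - 2 * (a * c + b * d))"
  proof -
    have "(cmod (y - 1))\<^sup>2 - (cmod (x - 1))\<^sup>2 + Re ((x - cnj x) * (cnj x * y - 1)) = 2 * a - 2 * c + 2 * b * (b * c - a * d)"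
      unfolding cmod_diff_1_power2[OF xy(1)] cmod_diff_1_power2[OF xy(2)] by (simp add: abcd algebra_simps)
    also have "\<dots> = 2 * a + 2 * (b\<^sup>2 - 1) * c - 2 * a * b * d" by (simp add: power2_eq_square algebra_simps)
    also have "b\<^sup>2 - 1 = - (a\<^sup>2)" using x by simp
    finally show ?thesis by (simp add: power2_eq_square algebra_simps)
  qed
  moreover have "\<bar>a\<bar> \<le> 1" using abs_Re_le_cmod[of x] xy by (simp add: abcd)
  ultimately show "\<bar>(cmod (y - 1))\<^sup>2 - (cmod (x - 1))\<^sup>2 + Re ((x - cnj x) * (cnj x * y - 1))\<bar> \<le> 12 * (cmod (x - y))\<^sup>2"
    using mult_right_mono[of "\<bar>a\<bar>" 1 "(cmod (x - y))\<^sup>2"] zero_le_power2[of "cmod (x - y)"]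
    by (simp add: abs_mult)
next
  fix x y :: complex and r assume xy: "cmod x = 1" "cmod y = 1" and r: "cmod (x - 1) \<le> r" "cmod (y - 1) \<le> r"
  \<comment> \<open>On the circle \<open>l z - 2 * z\<close> equals \<open>- 2 * Re z\<close>, which
    is the squared chord from 1 to \<open>z\<close> minus 2 and hence flat at 1.\<close>
  have "x - cnj x - (y - cnj y) - 2 * (x - y) = of_real (2 * Re y - 2 * Re x)"
    by (simp add: complex_eq_iff)
  then have "cmod (x - cnj x - (y - cnj y) - 2 * (x - y)) = \<bar>2 * Re y - 2 * Re x\<bar>"
    by (simp only: norm_of_real)
  also have "2 * Re y - 2 * Re x = (cmod (x - 1))\<^sup>2 - (cmod (y - 1))\<^sup>2"
    by (simp add: cmod_diff_1_power2 xy)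
  also have "\<dots> = (cmod (x - 1) - cmod (y - 1)) * (cmod (x - 1) + cmod (y - 1))"
    by (simp add: power2_eq_square algebra_simps)
  also have "\<bar>\<dots>\<bar> \<le> cmod (x - y) * (2 * r)"
    unfolding abs_mult
    using norm_triangle_ineq3[of "x - 1" "y - 1"] r by (intro mult_mono) auto
  also have "\<dots> \<le> 4 * r * cmod (x - y)"
    using r(1) order_trans[OF norm_ge_zero r(1)] by (simp add: mult_ac)
  finally show "cmod (x - cnj x - (y - cnj y) - 2 * (x - y)) \<le> 4 * r * cmod (x - y)" .
qed auto

text \<open>The disc stays in \<open>Re z \<ge> 1/2\<close>, away from the branch cut;
  \<open>1 / z - 1\<close> is the derivative of \<open>Ln z - z\<close>.\<close>

lemma near_1_bounds:
  assumes "cmod (z - 1) \<le> r" "r \<le> 1/2"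
  shows "z \<notin> \<real>\<^sub>\<le>\<^sub>0" "z \<noteq> 0" "cmod (1 / z - 1) \<le> 2 * r"
proof -
  have "Re z \<ge> 1/2"
    using assms abs_Re_le_cmod[of "z - 1"] by simp
  then show z: "z \<notin> \<real>\<^sub>\<le>\<^sub>0" "z \<noteq> 0" by (auto simp: complex_nonpos_Reals_iff)
  have "cmod z \<ge> 1/2" using \<open>Re z \<ge> 1/2\<close> complex_Re_le_cmod[of z] by linarith
  have "1 / z - 1 = (1 - z) / z" using z by (simp add: field_simps)
  then have "cmod (1 / z - 1) = cmod (z - 1) / cmod z"
    by (simp add: norm_divide norm_minus_commute)
  also have "\<dots> \<le> r / (1/2)"
    using assms \<open>cmod z \<ge> 1/2\<close> order_trans[OF norm_ge_zero assms(1)] by (intro frac_le) auto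
  finally show "cmod (1 / z - 1) \<le> 2 * r" by simp
qed

lemma Ln_diff_bound:
  assumes "cmod (x - 1) \<le> r" "cmod (y - 1) \<le> r" "r \<le> 1/2"
  shows "cmod ((Ln x - x) - (Ln y - y)) \<le> 2 * r * cmod (x - y)"
proof (rule field_differentiable_bound[where S = "cball 1 r" and f' = "\<lambda>z. 1 / z - 1"])
  fix z :: complex assume "z \<in> cball 1 r"
  then have z: "cmod (z - 1) \<le> r" by (simp add: dist_norm norm_minus_commute)
  show "((\<lambda>z. Ln z - z) has_field_derivative 1 / z - 1) (at z within cball 1 r)"
    using near_1_bounds(1)[OF z assms(3)] near_1_bounds(2)[OF z assms(3)]
    by (auto intro!: derivative_eq_intros simp: divide_simps)
  show "cmod (1 / z - 1) \<le> 2 * r" by (rule near_1_bounds(3)[OF z assms(3)])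
qed (use assms in \<open>auto simp: dist_norm norm_minus_commute\<close>)

lemma Ln_unit_circle:
  assumes "cmod z = 1"
  shows "Ln z = \<i> * of_real (Im (Ln z))" "z = exp (\<i> * of_real (Im (Ln z)))"
proof -
  have "z \<noteq> 0" using assms by auto
  then have "Re (Ln z) = 0" using assms Re_Ln[of z] by simp
  then show Ln: "Ln z = \<i> * of_real (Im (Ln z))" by (simp add: complex_eq_iff)
  show "z = exp (\<i> * of_real (Im (Ln z)))" using \<open>z \<noteq> 0\<close> by (simp flip: Ln)
qed

interpretation geodesic: circle_potential "\<lambda>z. (cmod (Ln z))\<^sup>2" "\<lambda>z. 2 * Ln z"
proof
  \<comment> \<open>The jump of \<open>Ln\<close> at -1 is only a change of sign on the circle, so
    the squared modulus is a continuous function of \<open>Re z\<close>.\<close>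
  have "(cmod (Ln z))\<^sup>2 = (arccos (Re z))\<^sup>2" if z: "cmod z = 1" for z
  proof -
    define t where "t = Im (Ln z)"
    have "z \<noteq> 0" using z by auto
    then have t: "\<bar>t\<bar> \<le> pi" using mpi_less_Im_Ln[of z] Im_Ln_le_pi[of z] by (auto simp: t_def)
    have "Re z = cos \<bar>t\<bar>" using arg_cong[OF Ln_unit_circle(2)[OF z], of Re] by (simp add: t_def Re_exp)
    then have "arccos (Re z) = \<bar>t\<bar>" using t arccos_cos[of "\<bar>t\<bar>"] by simp
    moreover have "cmod (Ln z) = \<bar>t\<bar>" by (subst Ln_unit_circle(1)[OF z]) (simp add: norm_mult t_def)
    ultimately show ?thesis by simp
  qed
  moreover have "continuous_on {z. cmod z = 1} (\<lambda>z. (arccos (Re z))\<^sup>2)"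
  proof (intro continuous_intros continuous_on_arccos ballI)
    fix z :: complex assume "z \<in> {z. cmod z = 1}"
    then show "- 1 \<le> Re z \<and> Re z \<le> 1" using abs_Re_le_cmod[of z] by (simp add: abs_le_iff)
  qed
  ultimately show "continuous_on {z. cmod z = 1} (\<lambda>z. (cmod (Ln z))\<^sup>2)"
    by (simp cong: continuous_on_cong_simp)
next
  fix z assume z: "cmod z = 1"
  have "cmod (z - 1) \<le> cmod (Ln z)"
    using cmod_exp_minus_1_le[of "Im (Ln z)"] arg_cong[OF Ln_unit_circle(1)[OF z], of cmod]
    by (simp add: norm_mult flip: Ln_unit_circle(2)[OF z])
  then show "(cmod (z - 1))\<^sup>2 \<le> (cmod (Ln z))\<^sup>2" by (intro power_mono) auto
  show "cnj (2 * Ln z) = - (2 * Ln z)"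
    by (subst (1 2) Ln_unit_circle(1)[OF z]) simp
next
  fix x y :: complex and r
  assume "cmod (x - 1) \<le> r" "cmod (y - 1) \<le> r" "r \<le> 1/2"
  then have "2 * cmod ((Ln x - x) - (Ln y - y)) \<le> 2 * (2 * r * cmod (x - y))"
    by (intro mult_left_mono Ln_diff_bound) auto
  moreover have "2 * Ln x - 2 * Ln y - 2 * (x - y) = 2 * ((Ln x - x) - (Ln y - y))"
    by (simp add: algebra_simps)
  ultimately show "cmod (2 * Ln x - 2 * Ln y - 2 * (x - y)) \<le> 4 * r * cmod (x - y)"
    by (simp only: norm_mult) simp
next
  fix x y :: complex
  assume xy: "cmod x = 1" "cmod y = 1" and near: "cmod (x - 1) \<le> 1/2" "cmod (y - 1) \<le> 1/2"
  define s t where "s = Im (Ln x)" and "t = Im (Ln y)"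
  have lip: "cmod (Ln u - Ln v) \<le> 2 * cmod (u - v)" if "cmod (u - 1) \<le> 1/2" "cmod (v - 1) \<le> 1/2" for u v
    using Ln_diff_bound[OF that order_refl] norm_triangle_ineq[of "(Ln u - u) - (Ln v - v)" "u - v"]
    by simp
  have Ln: "Ln x = \<i> * of_real s" "Ln y = \<i> * of_real t"
    unfolding s_def t_def by (rule Ln_unit_circle xy)+
  have exp: "x = exp (\<i> * of_real s)" "y = exp (\<i> * of_real t)"
    unfolding s_def t_def by (rule Ln_unit_circle xy)+
  have "Ln x - Ln y = \<i> * of_real (s - t)" by (simp add: Ln algebra_simps)
  then have "cmod (Ln x - Ln y) = \<bar>s - t\<bar>" by (simp only: norm_mult norm_ii norm_of_real mult_1)
  then have "\<bar>t - s\<bar> \<le> 2 * cmod (x - y)" using lip[OF near] by (simp add: abs_minus_commute)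
  then have "\<bar>t - s\<bar>\<^sup>2 \<le> (2 * cmod (x - y))\<^sup>2" by (intro power_mono) auto
  then have d: "(t - s)\<^sup>2 \<le> 4 * (cmod (x - y))\<^sup>2" by (simp add: power_mult_distrib)
  have s1: "\<bar>s\<bar> \<le> 1" using lip[of x 1] near by (simp add: Ln norm_mult)
  have "cnj x * y = exp (\<i> * of_real (t - s))"
    by (simp add: exp exp_cnj algebra_simps flip: exp_add)
  then have "(cmod (Ln y))\<^sup>2 - (cmod (Ln x))\<^sup>2 + Re (2 * Ln x * (cnj x * y - 1))
      = t\<^sup>2 - s\<^sup>2 - 2 * s * sin (t - s)"
    by (simp add: Ln norm_mult Im_exp)
  \<comment> \<open>With \<open>\<bar>s\<bar> \<le> 1\<close> this is at most three times the
    squared angle difference, and angles are at most twice chords here; this is the origin of the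
    constant 12.\<close>
  also have "\<dots> = (t - s)\<^sup>2 - 2 * s * (sin (t - s) - (t - s))"
    by (simp add: power2_eq_square algebra_simps)
  also have "\<bar>\<dots>\<bar> \<le> (t - s)\<^sup>2 + 2 * (1 * (t - s)\<^sup>2)"
  proof -
    have "\<bar>s\<bar> * \<bar>sin (t - s) - (t - s)\<bar> \<le> 1 * (t - s)\<^sup>2"
      by (intro mult_mono s1 abs_sin_diff_le) auto
    then have "\<bar>2 * s * (sin (t - s) - (t - s))\<bar> \<le> 2 * (1 * (t - s)\<^sup>2)" by (simp add: abs_mult)
    then show ?thesis using zero_le_power2[of "t - s"] by linarith
  qed
  finally show "\<bar>(cmod (Ln y))\<^sup>2 - (cmod (Ln x))\<^sup>2 + Re (2 * Ln x * (cnj x * y - 1))\<bar> \<le> 12 * (cmod (x - y))\<^sup>2"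
    using d by linarith
qed auto

text \<open>On the unit circle \<open>z - cnj z = z - 1/z = 2 sinh (Ln z)\<close>, which agrees with \<open>2 Ln z\<close> to second order.\<close>

lemma potential_derivatives_cubic:
  assumes z: "cmod z = 1" "cmod (z - 1) \<le> r" "r \<le> 1/2"
  shows "cmod (2 * Ln z - (z - cnj z)) \<le> 4 * r\<^sup>2 * cmod (z - 1)"
proof -
  \<comment> \<open>Replacing \<open>cnj z\<close> by \<open>1 / z\<close> gives a function
    holomorphic near 1. Its derivative is minus the square of \<open>1 / z - 1\<close>, which
    \<open>near_1_bounds\<close> makes quadratically small.\<close>
  have "cmod ((2 * Ln z - z + 1 / z) - (2 * Ln 1 - 1 + 1 / 1)) \<le> (2 * r)\<^sup>2 * cmod (z - 1)"
  proof (rule field_differentiable_bound[where S = "cball 1 r" and f' = "\<lambda>z. - ((1 / z - 1)\<^sup>2)"])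
    fix u :: complex assume "u \<in> cball 1 r"
    then have u: "cmod (u - 1) \<le> r" by (simp add: dist_norm norm_minus_commute)
    show "((\<lambda>z. 2 * Ln z - z + 1 / z) has_field_derivative - ((1 / u - 1)\<^sup>2)) (at u within cball 1 r)"
      using near_1_bounds(1)[OF u z(3)] near_1_bounds(2)[OF u z(3)]
      by (auto intro!: derivative_eq_intros simp: field_simps power2_eq_square)
    show "cmod (- ((1 / u - 1)\<^sup>2)) \<le> (2 * r)\<^sup>2"
      unfolding norm_minus_cancel norm_power by (intro power_mono near_1_bounds(3)[OF u z(3)]) simp
  qed (use z order_trans[OF norm_ge_zero z(2)] in \<open>auto simp: dist_norm norm_minus_commute\<close>)
  moreover have "1 / z = cnj z"
    using z(1) by (metis complex_div_cnj mult_1 div_by_1 of_real_1 power_one)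
  ultimately show ?thesis by (simp add: power_mult_distrib algebra_simps)
qed

section \<open>The two means as minimizers of the potentials\<close>

lemma chordal_\<Phi>:
  assumes W: "unitary W"
  shows "chordal.\<Phi> W = (norm (W - mat 1))\<^sup>2"
proof -
  obtain P a where D: "diagonalizes P a W" using unitary_diagonalizes[OF W] by blast
  show ?thesis unfolding chordal.\<Phi>_diagonalizes[OF D] norm_diff_mat_1[OF D] ..
qed

lemma geodesic_\<Phi>:
  assumes W: "unitary W"
  shows "geodesic.\<Phi> W = (norm (mlog W))\<^sup>2"
proof -
  obtain P a where D: "diagonalizes P a W" using unitary_diagonalizes[OF W] by blast
  show ?thesis unfolding geodesic.\<Phi>_diagonalizes[OF D] mlog_unitary[OF W] norm_fcalc[OF D] ..
qed

text \<open>Chords are shorter than arcs, eigenvalue by eigenvalue; the factor undoes the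
  normalization of \<open>unitary_dist\<close>. This brings the hypothesis on distances into the
  Frobenius norm.\<close>

lemma norm_diff_le_unitary_dist:
  assumes "unitary V" "unitary U"
  shows "norm (V - U) \<le> sqrt 2 * unitary_dist V U"
proof -
  have W: "unitary (ctranspose V ** U)" by (intro unitary_mult unitary_ctranspose assms)
  have "(norm (V - U))\<^sup>2 \<le> (norm (mlog (ctranspose V ** U)))\<^sup>2"
    using geodesic.\<Phi>_ge[OF W] geodesic_\<Phi>[OF W] norm_unitary_ctranspose_mult_diff[OF assms(1), of U] by simp
  then have "norm (V - U) \<le> norm (mlog (ctranspose V ** U))" by (rule power2_le_imp_le) simp
  then show ?thesis by (simp add: unitary_dist_def)
qed

lemma is_arithmetic_mean_iff:
  assumes U: "\<And>i. unitary (U i)"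
  shows "is_arithmetic_mean U w V \<longleftrightarrow> is_arg_min (chordal.objective w U) unitary V"
proof -
  have "arithmetic_objective U w V = chordal.objective w U V" if V: "unitary V" for V
  proof -
    have "chordal.\<Phi> (ctranspose V ** U i) = (norm (V - U i))\<^sup>2" for i
      using chordal_\<Phi>[of "ctranspose V ** U i"] U V
      by (simp add: unitary_mult unitary_ctranspose norm_unitary_ctranspose_mult_diff)
    then show ?thesis by (simp add: arithmetic_objective_def chordal.objective_def)
  qed
  then show ?thesis by (auto simp: is_arithmetic_mean_def is_arg_min_linorder)
qed

text \<open>The normalization of the distance makes the objectives differ by the factor 2, which
  leaves the minimizers unchanged.\<close>

lemma is_geometric_mean_iff:
  assumes U: "\<And>i. unitary (U i)"
  shows "is_geometric_mean U w V \<longleftrightarrow> is_arg_min (geodesic.objective w U) unitary V"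
proof -
  have eq: "geodesic.objective w U V = 2 * geometric_objective U w V" if V: "unitary V" for V
  proof -
    have "geodesic.\<Phi> (ctranspose V ** U i) = 2 * (unitary_dist V (U i))\<^sup>2" for i
      using geodesic_\<Phi>[of "ctranspose V ** U i"] U V
      by (simp add: unitary_mult unitary_ctranspose unitary_dist_def power_divide)
    then show ?thesis
      by (simp add: geometric_objective_def geodesic.objective_def sum_distrib_left mult.left_commute)
  qed
  show ?thesis by (auto simp: is_geometric_mean_def is_arg_min_linorder eq)
qed

text \<open>The difference of the two functions \<open>l\<close> vanishes at 1 and is controlled
  there with constant of order \<open>r^2\<close>; comparison of \<open>W\<close> with the identity
  supplies the third power.\<close>

lemma norm_gradient_diff_le:
  fixes U :: "'n::finite \<Rightarrow> complex^'m^'m" and w :: "real^'n"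
  assumes U: "\<And>i. unitary (U i)" and V: "unitary V" and near: "\<And>i. norm (V - U i) \<le> r" and r: "r \<le> 1/2"
  shows "norm (geodesic.gradient w U V - chordal.gradient w U V) \<le> (\<Sum>i\<in>UNIV. \<bar>w $ i\<bar>) * (4 * r ^ 3)"
proof -
  have "norm (fcalc (\<lambda>z. 2 * Ln z) (ctranspose V ** U i) - fcalc (\<lambda>z. z - cnj z) (ctranspose V ** U i)) \<le> 4 * r ^ 3" for i
  proof -
    define W where "W = ctranspose V ** U i"
    have W: "unitary W" unfolding W_def by (intro unitary_mult unitary_ctranspose U V)
    obtain P a where D: "diagonalizes P a W" using unitary_diagonalizes[OF W] by blast
    have W1: "norm (W - mat 1) \<le> r"
      using near[of i] by (simp add: W_def norm_unitary_ctranspose_mult_diff V)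
    let ?h = "\<lambda>z. 2 * Ln z - (z - cnj z)"
    have "norm (fcalc ?h W - fcalc ?h (mat 1)) \<le> 4 * r\<^sup>2 * norm (fcalc (\<lambda>z. z) W - fcalc (\<lambda>z. z) (mat 1))"
    proof (rule fcalc_lipschitz[OF D diagonalizes_mat_1])
      fix j k :: 'm
      have "cmod (a $ j - 1) \<le> r" using spectrum_diff_mat_1[OF D, of j] W1 by linarith
      then show "cmod (?h (a $ j) - ?h ((\<chi> i. 1) $ k)) \<le> 4 * r\<^sup>2 * cmod (a $ j - (\<chi> i. 1) $ k)"
        using potential_derivatives_cubic[OF diagonalizes_cmod[OF D W] _ r] by simp
    qed simp
    moreover have "fcalc ?h (mat 1) = (0 :: complex^'m^'m)"
    proof -
      have "(norm (fcalc ?h (mat 1 :: complex^'m^'m)))\<^sup>2 = 0"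
        unfolding norm_fcalc[OF diagonalizes_mat_1] by simp
      then show ?thesis by simp
    qed
    moreover have "fcalc ?h W = fcalc (\<lambda>z. 2 * Ln z) W - fcalc (\<lambda>z. z - cnj z) W"
      by (rule fcalc_diff[OF D])
    ultimately have "norm (fcalc (\<lambda>z. 2 * Ln z) W - fcalc (\<lambda>z. z - cnj z) W) \<le> 4 * r\<^sup>2 * norm (W - mat 1)"
      by (simp only: fcalc_id[OF D] fcalc_id[OF diagonalizes_mat_1] diff_0_right)
    also have "\<dots> \<le> 4 * r\<^sup>2 * r" by (intro mult_left_mono W1) simp
    finally show ?thesis by (simp add: W_def power2_eq_square power3_eq_cube)
  qed
  then have "norm (\<Sum>i\<in>UNIV. w $ i *\<^sub>R (fcalc (\<lambda>z. 2 * Ln z) (ctranspose V ** U i) - fcalc (\<lambda>z. z - cnj z) (ctranspose V ** U i)))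
      \<le> (\<Sum>i\<in>UNIV. \<bar>w $ i\<bar>) * (4 * r ^ 3)"
    by (rule sum_w_norm_le)
  then show ?thesis
    by (simp add: geodesic.gradient_def chordal.gradient_def scaleR_diff_right sum_subtractf)
qed

lemma means_of_close_unitaries:
  fixes w :: "real^'n::finite"
  assumes w: "(\<Sum>i\<in>UNIV. w $ i) = 1"
  shows "\<exists>\<delta>>0. \<exists>K. \<forall>(U :: 'n \<Rightarrow> complex^'m^'m) s. (\<forall>i. unitary (U i)) \<and> s \<le> \<delta> \<and> (\<forall>i j. norm (U i - U j) \<le> s) \<longrightarrow>
    (\<exists>!V. is_arithmetic_mean U w V) \<and> (\<exists>!V. is_geometric_mean U w V) \<and>
    norm (arithmetic_mean U w - geometric_mean U w) \<le> K * s ^ 3"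
proof -
  define \<Omega> where "\<Omega> = (\<Sum>i\<in>UNIV. \<bar>w $ i\<bar>)"
  have \<Omega>: "\<Omega> \<ge> 1" using sum_abs[of "($) w" UNIV] w by (simp add: \<Omega>_def)
  \<comment> \<open>The largest radius allowed by \<open>gradient_expanding\<close>; it is below 1/4
    because \<open>\<Omega> \<ge> 1\<close>.\<close>
  define r where "r = 1 / (6 * \<Omega>)"
  have r: "0 < r" "r \<le> 1/4" "r * (\<Sum>i\<in>UNIV. \<bar>w $ i\<bar>) \<le> 1/6"
    unfolding \<Omega>_def[symmetric] using \<Omega> by (simp_all add: r_def field_simps)
  obtain d1 where d1: "d1 > 0" and c: "\<And>(U :: 'n \<Rightarrow> complex^'m^'m) s. (\<forall>i. unitary (U i)) \<and> s \<le> d1 \<and> (\<forall>i j. norm (U i - U j) \<le> s) \<Longrightarrow>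
    (\<exists>V. (\<forall>V'. is_arg_min (chordal.objective w U) unitary V' \<longleftrightarrow> V' = V) \<and> unitary V \<and> chordal.gradient w U V = 0 \<and>
      (\<forall>i. norm (V - U i) \<le> min r (\<Omega> * (4 * s))))"
    using chordal.unique_minimizer[OF w r] unfolding \<Omega>_def by blast
  obtain d2 where d2: "d2 > 0" and g: "\<And>(U :: 'n \<Rightarrow> complex^'m^'m) s. (\<forall>i. unitary (U i)) \<and> s \<le> d2 \<and> (\<forall>i j. norm (U i - U j) \<le> s) \<Longrightarrow>
    (\<exists>V. (\<forall>V'. is_arg_min (geodesic.objective w U) unitary V' \<longleftrightarrow> V' = V) \<and> unitary V \<and> geodesic.gradient w U V = 0 \<and>
      (\<forall>i. norm (V - U i) \<le> min r (\<Omega> * (4 * s))))"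
    using geodesic.unique_minimizer[OF w r] unfolding \<Omega>_def by blast
  have main: "(\<exists>!V. is_arithmetic_mean U w V) \<and> (\<exists>!V. is_geometric_mean U w V) \<and>
    norm (arithmetic_mean U w - geometric_mean U w) \<le> (256 * \<Omega> ^ 4) * s ^ 3"
    if U: "\<forall>i. unitary (U i)" and s: "s \<le> min d1 d2" and close: "\<forall>i j. norm (U i - U j) \<le> s"
    for U :: "'n \<Rightarrow> complex^'m^'m" and s
  proof -
    obtain A where A: "\<And>V'. is_arithmetic_mean U w V' \<longleftrightarrow> V' = A" "unitary A" "chordal.gradient w U A = 0"
        "\<And>i. norm (A - U i) \<le> min r (\<Omega> * (4 * s))"
      using c[of U s] U s close is_arithmetic_mean_iff[of U w] by auto
    obtain G where G: "\<And>V'. is_geometric_mean U w V' \<longleftrightarrow> V' = G" "unitary G" "geodesic.gradient w U G = 0"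
        "\<And>i. norm (G - U i) \<le> min r (\<Omega> * (4 * s))"
      using g[of U s] U s close is_geometric_mean_iff[of U w] by auto
    \<comment> \<open>The predicates hold of exactly one matrix, so the choice inside
      \<open>arg_min\<close> has a known value.\<close>
    have "is_arg_min (arithmetic_objective U w) unitary = (\<lambda>V. V = A)"
      "is_arg_min (geometric_objective U w) unitary = (\<lambda>V. V = G)"
      using A(1) G(1) by (auto simp: is_arithmetic_mean_def is_geometric_mean_def)
    then have "arithmetic_mean U w = A" "geometric_mean U w = G"
      by (simp_all add: arithmetic_mean_def geometric_mean_def arg_min_def)
    moreover have "norm (A - G) \<le> (256 * \<Omega> ^ 4) * s ^ 3"
    proof -
      have "norm (A - G) \<le> norm (geodesic.gradient w U A - geodesic.gradient w U G)"
        by (rule geodesic.gradient_expanding[where r = r, OF _ A(2) G(2) w _ r(3)])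
          (use U r(2) A(4) G(4) in auto)
      also have "\<dots> = norm (geodesic.gradient w U A - chordal.gradient w U A)"
        by (simp add: A(3) G(3))
      also have "\<dots> \<le> \<Omega> * (4 * (min r (\<Omega> * (4 * s))) ^ 3)"
        unfolding \<Omega>_def
        by (rule norm_gradient_diff_le) (use U A(2) A(4) r(2) in \<open>auto simp: \<Omega>_def\<close>)
      also have "\<dots> \<le> \<Omega> * (4 * (\<Omega> * (4 * s)) ^ 3)"
      proof -
        \<comment> \<open>\<open>s\<close> carries no sign condition; nonnegativity is read off from
          the bound on a norm.\<close>
        have "0 \<le> min r (\<Omega> * (4 * s))" using A(4) norm_ge_zero order_trans by blast
        then have "(min r (\<Omega> * (4 * s))) ^ 3 \<le> (\<Omega> * (4 * s)) ^ 3" by (intro power_mono) auto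
        then show ?thesis using \<Omega> by (intro mult_left_mono) auto
      qed
      also have "\<dots> = (256 * \<Omega> ^ 4) * s ^ 3"
        by (simp add: power_mult_distrib power3_eq_cube power4_eq_xxxx)
      finally show ?thesis .
    qed
    ultimately show ?thesis using A(1) G(1) by auto
  qed
  show ?thesis
  proof (rule exI[of _ "min d1 d2"], rule conjI)
    show "min d1 d2 > 0" using d1 d2 by simp
  qed (rule exI[of _ "256 * \<Omega> ^ 4"], intro allI impI, elim conjE, rule main)
qed

theorem theorem2p7:
  fixes T :: real
    and U :: "'n::finite \<Rightarrow> real \<Rightarrow> complex^'m^'m"
    and w :: "real^'n"
  assumes "T > 0"
    and "\<And>i. continuous_on {0..T} (U i)"
    and "\<And>i t. t \<in> {0..T} \<Longrightarrow> unitary (U i t)"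
    and "\<exists>C>0. \<forall>i j. \<forall>t\<in>{0..T}. unitary_dist (U i t) (U j t) \<le> C * t"
    and "(\<Sum>i\<in>UNIV. w $ i) = 1"
  shows "(\<forall>\<^sub>F t in at 0 within {0..T}.
            (\<exists>!V. is_arithmetic_mean (\<lambda>i. U i t) w V) \<and>
            (\<exists>!V. is_geometric_mean (\<lambda>i. U i t) w V)) \<and>
         (\<lambda>t. norm (arithmetic_mean (\<lambda>i. U i t) w - geometric_mean (\<lambda>i. U i t) w))
            \<in> O[at 0 within {0..T}](\<lambda>t. t ^ 3)"
proof -
  obtain C where C: "C > 0" "\<And>i j t. t \<in> {0..T} \<Longrightarrow> unitary_dist (U i t) (U j t) \<le> C * t"
    using assms(4) by blast
  define c where "c = sqrt 2 * C"
  have "c > 0" using C(1) by (simp add: c_def)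
  obtain \<delta> K where \<delta>: "\<delta> > 0" and means: "\<And>(X :: 'n \<Rightarrow> complex^'m^'m) s.
      (\<forall>i. unitary (X i)) \<and> s \<le> \<delta> \<and> (\<forall>i j. norm (X i - X j) \<le> s) \<Longrightarrow>
      (\<exists>!V. is_arithmetic_mean X w V) \<and> (\<exists>!V. is_geometric_mean X w V) \<and>
      norm (arithmetic_mean X w - geometric_mean X w) \<le> K * s ^ 3"
    using means_of_close_unitaries[OF assms(5)] by blast
  \<comment> \<open>\<open>c * t\<close> plays the part of the closeness \<open>s\<close>; it must
    fall below the threshold of \<open>means_of_close_unitaries\<close>.\<close>
  have "\<forall>\<^sub>F t in at 0 within {0..T}. t \<in> {0..T} \<and> c * t \<le> \<delta>"
    unfolding eventually_at
    using \<open>c > 0\<close> \<delta> by (intro exI[of _ "\<delta> / c"]) (auto simp: dist_real_def field_simps)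
  then have ev: "\<forall>\<^sub>F t in at 0 within {0..T}. t \<in> {0..T} \<and>
      (\<exists>!V. is_arithmetic_mean (\<lambda>i. U i t) w V) \<and> (\<exists>!V. is_geometric_mean (\<lambda>i. U i t) w V) \<and>
      norm (arithmetic_mean (\<lambda>i. U i t) w - geometric_mean (\<lambda>i. U i t) w) \<le> K * (c * t) ^ 3"
  proof eventually_elim
    case (elim t)
    have "norm (U i t - U j t) \<le> c * t" for i j
    proof -
      have "norm (U i t - U j t) \<le> sqrt 2 * unitary_dist (U i t) (U j t)"
        using elim assms(3) by (intro norm_diff_le_unitary_dist) auto
      also have "\<dots> \<le> sqrt 2 * (C * t)" using elim C(2) by (intro mult_left_mono) auto
      finally show ?thesis by (simp add: c_def)
    qed
    then show ?case using means[of "\<lambda>i. U i t" "c * t"] elim assms(3) by auto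
  qed
  have "(\<lambda>t. norm (arithmetic_mean (\<lambda>i. U i t) w - geometric_mean (\<lambda>i. U i t) w))
      \<in> O[at 0 within {0..T}](\<lambda>t. t ^ 3)"
  proof (rule bigoI[of _ "K * c ^ 3"])
    show "\<forall>\<^sub>F t in at 0 within {0..T}. norm (norm (arithmetic_mean (\<lambda>i. U i t) w - geometric_mean (\<lambda>i. U i t) w))
        \<le> K * c ^ 3 * norm (t ^ 3)"
      using ev by eventually_elim (auto simp: power_mult_distrib mult.assoc)
  qed
  moreover have "\<forall>\<^sub>F t in at 0 within {0..T}.
      (\<exists>!V. is_arithmetic_mean (\<lambda>i. U i t) w V) \<and> (\<exists>!V. is_geometric_mean (\<lambda>i. U i t) w V)"
    using ev by eventually_elim blast
  ultimately show ?thesis by blast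
qed

end
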